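(* Let $b\ge0$, $x<b$, $\rho\in(0,1]$, let $g:\mathbb{R}\to[0,\infty)$ be measurable, and write $\tau=\tau_b=\inf\{k\in\mathbb{N}_0:X_k\ge b\}$. Then $$E_x\big(\rho^\tau g(X_\tau)\big)=\sum_{i\in E}E_x\big(\rho^\tau\mathbf 1_{G_i}\big)\,E\big(g(b+R^i)\big),$$ where $R^i$ is a $PH(Q,e_i)$-distributed random variable. Here the integrands $\rho^\tau g(X_\tau)$ and $\rho^\tau\mathbf 1_{G_i}$ are set equal to $0$ on $\{\tau=\infty\}$.
   Context: $\mathbb{N}=\{1,2,\dots\}$, $\mathbb{N}_0=\mathbb{N}\cup\{0\}$. Phasetype distributions: let $m\in\mathbb{N}$, $E=\{1,\dots,m\}$, $\Delta=m+1$, and consider continuous-time Markov chains on $E\cup\{\Delta\}$ in which $1,\dots,m$ are transient and $\Delta$ is absorbing, with generator $\hat Q=\begin{pmatrix}Q&-Q\mathbf 1\\0&0\end{pmatrix}$, where $Q$ is an $m\times m$ matrix and $\mathbf 1$ is the all-ones column vector. For a probability row vector $\alpha=(\alpha_1,\dots,\alpha_m)$, $PH(Q,\alpha)$ denotes the distribution of the absorption time $\eta=\inf\{t\ge0:J_t=\Delta\}$ of such a chain $(J_t)$ started with initial distribution $(\alpha,0)$. $e_i$ is the $i$-th unit (row) vector. Process: let $0<\lambda<1$ and $X_n=\lambda X_{n-1}+Z_n$, $n\in\mathbb{N}$, where the innovations $Z_n=S_n-T_n$ are i.i.d., $S_n,T_n\ge 0$ are independent, $S_n$ is $PH(Q,\alpha)$-distributed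 and $T_n$ has an arbitrary distribution on $[0,\infty)$. $P_x$, $E_x$ denote probability and expectation under $X_0=x$. For each $n$ let $S_n$ be realized as the absorption time of a Markov chain $(J^{(n)}_t)_{t\ge0}$ with generator $\hat Q$ and initial distribution $(\alpha,0)$; the chains $J^{(n)}$, $n\in\mathbb{N}$, and the variables $T_n$, $n\in\mathbb{N}$, are all independent, the $J^{(n)}$ being identically distributed and the $T_n$ being identically distributed. Embedding: for $t\ge0$ put $n_t=\max\{n\in\mathbb{N}_0:\sum_{k=1}^nS_k\le t\}$, $$J_t=J^{(n_t+1)}_{t-\sum_{k=1}^{n_t}S_k},\qquad Y_t=\lambda X_{n_t}-T_{n_t+1}+t-\sum_{k=1}^{n_t}S_k,$$ $\hat\tau=\inf\{t\ge0:Y_t\ge b\}$, and $G_i=\{\hat\tau<\infty,\ J_{\hat\tau}=i\}$ for $i\in E$. *)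

theory Defs
  imports "HOL-Probability.Probability"
begin

definition matrix_exp :: "real^'s^'s \<Rightarrow> real^'s^('s::finite)" where
  "matrix_exp A = (\<Sum>k. (1 / fact k) *\<^sub>R (((**) A) ^^ k) (mat 1))"

definition is_generator :: "real^'s^('s::finite) \<Rightarrow> bool" where
  "is_generator A \<longleftrightarrow>
     (\<forall>i j. i \<noteq> j \<longrightarrow> 0 \<le> A $ i $ j) \<and> (\<forall>i. (\<Sum>j\<in>UNIV. A $ i $ j) = 0)"

text \<open>Values of a path at negative times are irrelevant. Since the state space is discrete, right-continuity means that the path
  is locally constant to the right.\<close>

definition right_cont_path :: "(real \<Rightarrow> 's) \<Rightarrow> bool" where
  "right_cont_path w \<longleftrightarrow> (\<forall>t\<ge>0. \<exists>e>0. \<forall>u. t \<le> u \<and> u < t + e \<longrightarrow> w u = w t)"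

text \<open>\<open>ctmc M J A \<nu>\<close>: on the probability space \<open>M\<close>, the process \<open>(J \<omega> t)\<close>, \<open>t \<ge> 0\<close>, is a
  right-continuous Markov chain with initial distribution \<open>\<nu>\<close> and generator \<open>A\<close>, that is, with
  transition matrices \<open>P(t) = exp (t A)\<close>. The last conjunct is the Markov property
  with the conditional probability multiplied out, so that conditioning events of
  probability 0 need no special treatment.\<close>

definition ctmc ::
  "'w measure \<Rightarrow> ('w \<Rightarrow> real \<Rightarrow> 's) \<Rightarrow> real^'s^('s::finite) \<Rightarrow> real^'s \<Rightarrow> bool" where
  "ctmc M J A \<nu> \<longleftrightarrow>
     prob_space M \<and>
     (\<forall>t\<ge>0. (\<lambda>\<omega>. J \<omega> t) \<in> M \<rightarrow>\<^sub>M count_space UNIV) \<and>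
     (\<forall>\<omega>\<in>space M. right_cont_path (J \<omega>)) \<and>
     (\<forall>i. measure M {\<omega>\<in>space M. J \<omega> 0 = i} = \<nu> $ i) \<and>
     (\<forall>(n::nat) (t::nat \<Rightarrow> real) (s::nat \<Rightarrow> 's).
        0 \<le> t 0 \<and> (\<forall>k\<le>n. t k \<le> t (Suc k)) \<longrightarrow>
        measure M {\<omega>\<in>space M. \<forall>k\<le>Suc n. J \<omega> (t k) = s k} =
        measure M {\<omega>\<in>space M. \<forall>k\<le>n. J \<omega> (t k) = s k} *
          matrix_exp ((t (Suc n) - t n) *\<^sub>R A) $ s n $ s (Suc n))"

text \<open>Under the chain started in \<open>i\<close>, the set of times spent in \<open>i\<close> is almost surely bounded.
  Any right-continuous chain can be transported to a space of paths, so quantifying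
  over measures on \<open>real \<Rightarrow> 's\<close> (with an arbitrary \<open>space\<close>, in particular the set of
  right-continuous paths) loses no generality.\<close>

definition transient_state :: "real^'s^'s \<Rightarrow> ('s::finite) \<Rightarrow> bool" where
  "transient_state A i \<longleftrightarrow>
     (\<forall>P :: (real \<Rightarrow> 's) measure. ctmc P (\<lambda>w. w) A (axis i 1) \<longrightarrow>
        (AE w in P. bdd_above {t. 0 \<le> t \<and> w t = i}))"

text \<open>The transient states \<open>E\<close> are the elements of a finite type \<open>'m\<close>; the state space
  \<open>E \<union> {\<Delta>}\<close> is \<open>'m option\<close>, with \<open>\<Delta> = None\<close>.\<close>

definition absorbing_generator :: "real^'m^('m::finite) \<Rightarrow> real^('m option)^('m option)" where
  "absorbing_generator Q = (\<chi> r c.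
     case r of None \<Rightarrow> 0
     | Some i \<Rightarrow> (case c of None \<Rightarrow> - (\<Sum>j\<in>UNIV. Q $ i $ j) | Some j \<Rightarrow> Q $ i $ j))"

definition initial_dist :: "real^('m::finite) \<Rightarrow> real^('m option)" where
  "initial_dist \<alpha> = (\<chi> r. case r of None \<Rightarrow> 0 | Some i \<Rightarrow> \<alpha> $ i)"

definition absorption_time :: "(real \<Rightarrow> 'm option) \<Rightarrow> ereal" where
  "absorption_time w = (INF t\<in>{t. 0 \<le> t \<and> w t = None}. ereal t)"

text \<open>\<open>phase_type Q \<alpha> D\<close>: the measure \<open>D\<close> is the distribution \<open>PH(Q, \<alpha>)\<close>. As for
  \<^const>\<open>transient_state\<close>, the chain may be taken on a space of paths. When all states of
  \<open>E\<close> are transient, the absorption time is almost surely finite, so its conversion to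
  \<^typ>\<open>real\<close> (which maps \<open>\<infinity>\<close> to 0) only matters on a null set.\<close>

definition phase_type :: "real^'m^'m \<Rightarrow> real^('m::finite) \<Rightarrow> real measure \<Rightarrow> bool" where
  "phase_type Q \<alpha> D \<longleftrightarrow>
     (\<exists>P :: (real \<Rightarrow> 'm option) measure.
        ctmc P (\<lambda>w. w) (absorbing_generator Q) (initial_dist \<alpha>) \<and>
        D = distr P borel (\<lambda>w. real_of_ereal (absorption_time w)))"

definition process_sigma :: "'w measure \<Rightarrow> ('w \<Rightarrow> real \<Rightarrow> 's) \<Rightarrow> 'w set set" where
  "process_sigma M J = sets (vimage_algebra (space M)
     (\<lambda>\<omega>. restrict (J \<omega>) {0..}) (PiM {0..} (\<lambda>_. count_space UNIV)))"

definition variable_sigma :: "'w measure \<Rightarrow> ('w \<Rightarrow> real) \<Rightarrow> 'w set set" where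
  "variable_sigma M V = sets (vimage_algebra (space M) V borel)"

text \<open>The following notions are pathwise: the arguments are the realized sequences
  \<open>s = (S\<^sub>n)\<close>, \<open>u = (T\<^sub>n)\<close>, \<open>x = (X\<^sub>n)\<close> and \<open>j = (J\<^sup>(\<^sup>n\<^sup>))\<close>. The entries with
  index 0 of \<open>s\<close>, \<open>u\<close> and \<open>j\<close> are not used.\<close>

definition first_passage :: "real \<Rightarrow> (nat \<Rightarrow> real) \<Rightarrow> enat" where
  "first_passage b x = (INF k\<in>{k. b \<le> x k}. enat k)"

text \<open>The maximum exists unless the partial sums stay bounded by \<open>t\<close>, which has
  probability 0.\<close>

definition renewal_count :: "(nat \<Rightarrow> real) \<Rightarrow> real \<Rightarrow> nat" where
  "renewal_count s t = Max {n. (\<Sum>k=1..n. s k) \<le> t}"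

definition embedded_phase ::
  "(nat \<Rightarrow> real \<Rightarrow> 'm option) \<Rightarrow> (nat \<Rightarrow> real) \<Rightarrow> real \<Rightarrow> 'm option" where
  "embedded_phase j s t =
     (let n = renewal_count s t in j (n + 1) (t - (\<Sum>k=1..n. s k)))"

definition embedded_level ::
  "real \<Rightarrow> (nat \<Rightarrow> real) \<Rightarrow> (nat \<Rightarrow> real) \<Rightarrow> (nat \<Rightarrow> real) \<Rightarrow> real \<Rightarrow> real" where
  "embedded_level lam x u s t =
     (let n = renewal_count s t in lam * x n - u (n + 1) + t - (\<Sum>k=1..n. s k))"

definition level_passage :: "real \<Rightarrow> (real \<Rightarrow> real) \<Rightarrow> ereal" where
  "level_passage b y = (INF t\<in>{t. 0 \<le> t \<and> b \<le> y t}. ereal t)"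

text \<open>\<open>\<rho>\<^sup>\<tau> f(\<tau>)\<close>, set to 0 where \<open>\<tau> = \<infinity>\<close>.\<close>

definition discounted :: "real \<Rightarrow> enat \<Rightarrow> (nat \<Rightarrow> real) \<Rightarrow> real" where
  "discounted \<rho> \<tau> f = (case \<tau> of enat k \<Rightarrow> \<rho> ^ k * f k | \<infinity> \<Rightarrow> 0)"

end

theory Submission imports Defs
begin

text \<open>
  Let \<open>X\<^sub>n < b\<close>. The next value \<open>X\<^sub>n\<^sub>+\<^sub>1\<close> arises from \<open>lam * X\<^sub>n - T\<^sub>n\<^sub>+\<^sub>1\<close>, which is below \<open>b\<close>, by an upward
  motion with unit speed that lasts for the phase-type lifetime \<open>S\<^sub>n\<^sub>+\<^sub>1\<close>. It crosses \<open>b\<close> if and only if this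
  lifetime is at least the crossing age \<open>W\<^sub>n = b - lam * X\<^sub>n + T\<^sub>n\<^sub>+\<^sub>1 > 0\<close>, and then
  \<open>X\<^sub>n\<^sub>+\<^sub>1 = b + (S\<^sub>n\<^sub>+\<^sub>1 - W\<^sub>n)\<close>: the overshoot is the residual lifetime at age \<open>W\<^sub>n\<close>. Since \<open>W\<^sub>n\<close>, together with the
  event that \<open>b\<close> was not reached before, is independent of the chain \<open>J\<^sup>(\<^sup>n\<^sup>+\<^sup>1\<^sup>)\<close>, the Markov property of the chain at time
  \<open>W\<^sub>n\<close> shows that the overshoot has the law \<open>PH(Q, e\<^sub>i)\<close> given that the chain is then in phase \<open>i\<close>
  (\<open>overshoot\<close>). The embedded process is at that moment at its first passage of \<open>b\<close>
  and in the same phase (\<open>embedded_passage\<close>), so that the phase identifies the event \<open>G\<^sub>i\<close>. Multiplying by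
  \<open>\<rho>\<^sup>n\<^sup>+\<^sup>1\<close> and summing over \<open>n\<close> and \<open>i\<close> gives the claim.

  Three facts about chains support this. The lifetime is almost surely finite; this is where
  transience enters, through a pigeonhole argument that needs only the return probabilities
  (\<open>AE_absorption_finite\<close>). The lifetime has no atoms at positive times, so that crossing \<open>b\<close>
  and ending exactly on \<open>b\<close> need not be distinguished (\<open>AE_lifetime_neq\<close>). The state at an
  independent random time is integrated by Fubini's theorem, which needs joint measurability in time and
  chance (\<open>measurable_right_cont_process\<close>, \<open>nn_integral_indep_parameter\<close>).\<close>

section \<open>Exponentials of matrices with a zero row\<close>

text \<open>A bound on the entries suffices for absolute convergence of the exponential series, and it avoids
  the choice of a submultiplicative norm.\<close>

lemma abs_matrix_power_entry_le:
  fixes A :: "real^'n^('n::finite)"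
  shows "\<bar>(((**) A) ^^ k) (mat 1) $ i $ j\<bar> \<le> (\<Sum>p\<in>UNIV. \<Sum>q\<in>UNIV. \<bar>A $ p $ q\<bar>) ^ k"
proof (induction k arbitrary: i j)
  case 0
  show ?case by (simp add: mat_def)
next
  case (Suc k)
  let ?B = "(((**) A) ^^ k) (mat 1)" and ?c = "\<Sum>p\<in>UNIV. \<Sum>q\<in>UNIV. \<bar>A $ p $ q\<bar>"
  have "\<bar>(((**) A) ^^ Suc k) (mat 1) $ i $ j\<bar> = \<bar>\<Sum>l\<in>UNIV. A $ i $ l * ?B $ l $ j\<bar>"
    by (simp add: matrix_matrix_mult_def)
  also have "\<dots> \<le> (\<Sum>l\<in>UNIV. \<bar>A $ i $ l\<bar> * \<bar>?B $ l $ j\<bar>)"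
    by (rule order_trans[OF sum_abs]) (simp add: abs_mult)
  also have "\<dots> \<le> (\<Sum>l\<in>UNIV. \<bar>A $ i $ l\<bar> * ?c ^ k)"
    by (intro sum_mono mult_left_mono Suc.IH) auto
  also have "\<dots> = (\<Sum>l\<in>UNIV. \<bar>A $ i $ l\<bar>) * ?c ^ k"
    by (simp add: sum_distrib_right)
  also have "\<dots> \<le> ?c * ?c ^ k"
  proof (intro mult_right_mono zero_le_power sum_nonneg)
    show "(\<Sum>l\<in>UNIV. \<bar>A $ i $ l\<bar>) \<le> ?c"
      by (rule member_le_sum[of i UNIV "\<lambda>p. \<Sum>q\<in>UNIV. \<bar>A $ p $ q\<bar>"]) (auto intro: sum_nonneg)
  qed auto
  finally show ?case by simp
qed

text \<open>The exponential is a series of matrices; convergence allows it to be evaluated entry by entry.\<close>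

lemma matrix_exp_entry:
  fixes A :: "real^'n^('n::finite)"
  shows "matrix_exp A $ i $ j = (\<Sum>k. (1 / fact k) * (((**) A) ^^ k) (mat 1) $ i $ j)"
proof -
  let ?P = "\<lambda>k. (((**) A) ^^ k) (mat 1)" and ?c = "\<Sum>p\<in>UNIV. \<Sum>q\<in>UNIV. \<bar>A $ p $ q\<bar>"
  have "summable (\<lambda>k. (1 / fact k) *\<^sub>R ?P k)"
  proof (rule summable_comparison_test')
    show "summable (\<lambda>k. (real CARD('n) * real CARD('n)) * (inverse (fact k) * ?c ^ k))"
      by (intro summable_mult summable_exp)
    fix k
    have "norm (?P k) \<le> (\<Sum>p\<in>UNIV. norm (?P k $ p))"
      unfolding norm_vec_def[of "?P k"] by (rule L2_set_le_sum) simp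
    also have "\<dots> \<le> (\<Sum>p\<in>(UNIV::'n set). \<Sum>q\<in>UNIV. \<bar>?P k $ p $ q\<bar>)"
      by (intro sum_mono norm_le_l1_cart)
    also have "\<dots> \<le> (\<Sum>p\<in>(UNIV::'n set). \<Sum>q\<in>(UNIV::'n set). ?c ^ k)"
      by (intro sum_mono abs_matrix_power_entry_le)
    finally show "norm ((1 / fact k) *\<^sub>R ?P k)
        \<le> (real CARD('n) * real CARD('n)) * (inverse (fact k) * ?c ^ k)"
      by (simp add: divide_simps mult_ac)
  qed
  then have "(\<lambda>k. (1 / fact k) *\<^sub>R ?P k) sums matrix_exp A"
    unfolding matrix_exp_def by (rule summable_sums)
  then have "(\<lambda>k. ((1 / fact k) *\<^sub>R ?P k) $ i $ j) sums (matrix_exp A $ i $ j)"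
    by (intro sums_vec_nth)
  then show ?thesis
    by (simp add: sums_iff)
qed

text \<open>All positive powers of \<open>A\<close> inherit the zero row, so only the identity matrix contributes.\<close>

lemma matrix_exp_zero_row:
  fixes A :: "real^'n^('n::finite)"
  assumes "\<And>j. A $ i $ j = 0"
  shows "matrix_exp A $ i $ j = (if i = j then 1 else 0)"
proof -
  have "(((**) A) ^^ k) (mat 1) $ i $ j = 0" if "k \<noteq> 0" for k
    using that assms by (cases k) (auto simp: matrix_matrix_mult_def)
  then have "(\<Sum>k. (1 / fact k) * (((**) A) ^^ k) (mat 1) $ i $ j)
      = (\<Sum>k\<in>{0}. (1 / fact k) * (((**) A) ^^ k) (mat 1) $ i $ j)"
    by (intro suminf_finite) auto
  then show ?thesis
    by (simp add: matrix_exp_entry mat_def)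
qed

section \<open>Absorption of right-continuous paths\<close>

text \<open>Absorbing generators only give this property almost surely; a single path of the chain may well leave
  \<open>None\<close> again.\<close>

definition absorbed :: "(real \<Rightarrow> 'm option) \<Rightarrow> bool" where
  "absorbed w \<longleftrightarrow> (\<forall>s t. 0 \<le> s \<and> s \<le> t \<and> w s = None \<longrightarrow> w t = None)"

lemma right_cont_pathE:
  assumes "right_cont_path w" "0 \<le> t"
  obtains e where "0 < e" "\<And>u. t \<le> u \<Longrightarrow> u < t + e \<Longrightarrow> w u = w t"
  using assms unfolding right_cont_path_def by blast

lemma right_cont_path_rational:
  assumes "right_cont_path w" "0 \<le> t" "t < c"
  obtains q where "q \<in> \<rat>" "t < q" "q < c" "w q = w t"
proof -
  obtain e where e: "0 < e" "\<And>u. t \<le> u \<Longrightarrow> u < t + e \<Longrightarrow> w u = w t"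
    using right_cont_pathE[OF assms(1,2)] by blast
  obtain q where "q \<in> \<rat>" "t < q" "q < min c (t + e)"
    using Rats_dense_in_real[of t "min c (t + e)"] assms(3) e(1) by auto
  with e(2)[of q] show ?thesis by (intro that[of q]) auto
qed

text \<open>Right-continuity spreads absorption from the countably many pairs of rational times, where null
  events can be discarded, to all pairs of times.\<close>

lemma absorbed_if_rational:
  assumes w: "right_cont_path w"
    and rat: "\<And>s t. s \<in> \<rat> \<Longrightarrow> t \<in> \<rat> \<Longrightarrow> 0 \<le> s \<Longrightarrow> s \<le> t \<Longrightarrow> w s = None \<Longrightarrow> w t = None"
  shows "absorbed w"
  unfolding absorbed_def
proof safe
  fix s t assume st: "0 \<le> s" "s \<le> t" "w s = None"
  show "w t = None"
  proof (cases "s = t")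
    case False
    obtain p where p: "p \<in> \<rat>" "s < p" "p < t" "w p = w s"
      using right_cont_path_rational[OF w, of s t] False st by auto
    obtain q where q: "q \<in> \<rat>" "t < q" "w q = w t"
      using right_cont_path_rational[OF w, of t "t + 1"] st by auto
    show ?thesis
      using rat[of p q] p q st by auto
  qed (use st in simp)
qed

lemma absorption_time_nonneg: "0 \<le> absorption_time w"
  unfolding absorption_time_def by (intro INF_greatest) auto

text \<open>By right-continuity the times spent in \<open>None\<close> contain their infimum, and by absorption
  everything after it.\<close>

lemma absorption_time_le_iff:
  assumes w: "right_cont_path w" and abs: "absorbed w" and t: "0 \<le> t"
  shows "absorption_time w \<le> ereal t \<longleftrightarrow> w t = None"
proof
  assume le: "absorption_time w \<le> ereal t"
  obtain e where e: "0 < e" "\<And>u. t \<le> u \<Longrightarrow> u < t + e \<Longrightarrow> w u = w t"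
    using right_cont_pathE[OF w t] by blast
  have "absorption_time w < ereal (t + e)"
    using le e(1) by (simp add: le_less_trans)
  then obtain u where u: "0 \<le> u" "w u = None" "u < t + e"
    unfolding absorption_time_def INF_less_iff by auto
  show "w t = None"
  proof (cases "u \<le> t")
    case True
    then show ?thesis using abs u unfolding absorbed_def by blast
  next
    case False
    then show ?thesis using e(2)[of u] u by auto
  qed
next
  assume "w t = None"
  then show "absorption_time w \<le> ereal t"
    unfolding absorption_time_def using t by (intro INF_lower) auto
qed

text \<open>A path is in \<open>None\<close> at rational times arbitrarily close to its absorption time; the
  countable infimum makes the absorption time measurable.\<close>

lemma absorption_time_rational:
  assumes w: "right_cont_path w"
  shows "absorption_time w = (INF q\<in>\<rat> \<inter> {0..}. if w q = None then ereal q else \<infinity>)"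
proof (rule antisym)
  show "absorption_time w \<le> (INF q\<in>\<rat> \<inter> {0..}. if w q = None then ereal q else \<infinity>)"
    unfolding absorption_time_def by (intro INF_greatest) (auto intro: INF_lower)
  show "(INF q\<in>\<rat> \<inter> {0..}. if w q = None then ereal q else \<infinity>) \<le> absorption_time w"
    unfolding absorption_time_def
  proof (rule INF_greatest, clarify)
    fix t assume t: "0 \<le> t" "w t = None"
    show "(INF q\<in>\<rat> \<inter> {0..}. if w q = None then ereal q else \<infinity>) \<le> ereal t"
    proof (rule ereal_le_epsilon2)
      fix e :: real assume "0 < e"
      then obtain q where q: "q \<in> \<rat>" "t < q" "q < t + e" "w q = w t"
        using right_cont_path_rational[OF w t(1), of "t + e"] by auto
      have "(INF q\<in>\<rat> \<inter> {0..}. if w q = None then ereal q else \<infinity>) \<le> ereal q"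
        by (rule INF_lower2[of q]) (use q t in auto)
      also have "\<dots> \<le> ereal t + ereal e" using q by simp
      finally show "(INF q\<in>\<rat> \<inter> {0..}. if w q = None then ereal q else \<infinity>) \<le> ereal t + ereal e" .
    qed
  qed
qed

lemma borel_measurable_absorption_time:
  assumes J: "\<And>t. 0 \<le> t \<Longrightarrow> (\<lambda>\<omega>. J \<omega> t) \<in> F \<rightarrow>\<^sub>M count_space UNIV"
    and w: "\<And>\<omega>. \<omega> \<in> space F \<Longrightarrow> right_cont_path (J \<omega>)"
  shows "(\<lambda>\<omega>. absorption_time (J \<omega>)) \<in> borel_measurable F"
proof -
  have "(\<lambda>\<omega>. INF q\<in>\<rat> \<inter> {0..}. if J \<omega> q = None then ereal q else \<infinity>) \<in> borel_measurable F"
  proof (rule borel_measurable_INF)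
    show "countable (\<rat> \<inter> {0..} :: real set)"
      using countable_rat by (rule countable_subset[rotated]) auto
    fix q :: real assume "q \<in> \<rat> \<inter> {0..}"
    then have "(\<lambda>\<omega>. J \<omega> q) \<in> F \<rightarrow>\<^sub>M count_space UNIV" using J by simp
    then show "(\<lambda>\<omega>. if J \<omega> q = None then ereal q else \<infinity>) \<in> borel_measurable F"
      by measurable
  qed
  then show ?thesis
    by (subst measurable_cong[OF absorption_time_rational[OF w]])
qed

text \<open>The real-valued absorption time, where paths that are never absorbed are given the lifetime 0.\<close>

definition lifetime :: "(real \<Rightarrow> 'm option) \<Rightarrow> real" where
  "lifetime w = real_of_ereal (absorption_time w)"

lemma lifetime_nonneg: "0 \<le> lifetime w"
  unfolding lifetime_def using absorption_time_nonneg by (rule real_of_ereal_pos)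

section \<open>Transition probabilities of Markov chains\<close>

lemma initial_dist_axis: "initial_dist (axis i 1) = axis (Some i) 1"
  by (auto simp: initial_dist_def axis_def vec_eq_iff split: option.split)

context
  fixes M :: "'w measure" and J :: "'w \<Rightarrow> real \<Rightarrow> ('s::finite)" and A :: "real^'s^'s" and \<nu> :: "real^'s"
  assumes chain: "ctmc M J A \<nu>"
begin

lemma ctmc_prob_space: "prob_space M"
  using chain unfolding ctmc_def by blast

lemma ctmc_measurable: "0 \<le> t \<Longrightarrow> (\<lambda>\<omega>. J \<omega> t) \<in> M \<rightarrow>\<^sub>M count_space UNIV"
  using chain unfolding ctmc_def by blast

lemma ctmc_right_cont: "\<omega> \<in> space M \<Longrightarrow> right_cont_path (J \<omega>)"
  using chain unfolding ctmc_def by blast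

lemma ctmc_initial: "measure M {\<omega>\<in>space M. J \<omega> 0 = i} = \<nu> $ i"
  using chain unfolding ctmc_def by blast

lemma ctmc_sets: "0 \<le> t \<Longrightarrow> {\<omega>\<in>space M. J \<omega> t = a} \<in> sets M"
  using ctmc_measurable by measurable

lemma ctmc_two_times:
  assumes "0 \<le> s" "s \<le> t"
  shows "measure M {\<omega>\<in>space M. J \<omega> s = a \<and> J \<omega> t = c}
       = measure M {\<omega>\<in>space M. J \<omega> s = a} * matrix_exp ((t - s) *\<^sub>R A) $ a $ c"
proof -
  let ?t = "\<lambda>k::nat. if k = 0 then s else t" and ?s = "\<lambda>k::nat. if k = 0 then a else c"
  have "0 \<le> ?t 0 \<and> (\<forall>k\<le>0. ?t k \<le> ?t (Suc k)) \<longrightarrow>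
        measure M {\<omega>\<in>space M. \<forall>k\<le>Suc 0. J \<omega> (?t k) = ?s k} =
        measure M {\<omega>\<in>space M. \<forall>k\<le>0. J \<omega> (?t k) = ?s k} *
          matrix_exp ((?t (Suc 0) - ?t 0) *\<^sub>R A) $ ?s 0 $ ?s (Suc 0)"
    using chain unfolding ctmc_def by (elim conjE) (erule allE[of _ 0], erule allE[of _ ?t], erule allE[of _ ?s])
  moreover have "(\<forall>k\<le>Suc 0. J \<omega> (?t k) = ?s k) \<longleftrightarrow> J \<omega> s = a \<and> J \<omega> t = c" for \<omega>
    by (auto simp: le_Suc_eq)
  ultimately show ?thesis using assms by simp
qed

lemma ctmc_start:
  assumes start: "\<nu> = axis i 1" and t: "0 \<le> t"
  shows "AE \<omega> in M. J \<omega> 0 = i"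
    and "measure M {\<omega>\<in>space M. J \<omega> t = c} = matrix_exp (t *\<^sub>R A) $ i $ c"
proof -
  interpret prob_space M by (rule ctmc_prob_space)
  have one: "prob {\<omega>\<in>space M. J \<omega> 0 = i} = 1"
    by (simp add: ctmc_initial start axis_def)
  then show AE: "AE \<omega> in M. J \<omega> 0 = i"
    by (subst (asm) prob_eq_1) (use ctmc_sets[of 0] in auto)
  have "prob {\<omega>\<in>space M. J \<omega> t = c} = prob {\<omega>\<in>space M. J \<omega> 0 = i \<and> J \<omega> t = c}"
    by (rule finite_measure_eq_AE) (use AE ctmc_measurable[OF t] ctmc_measurable[of 0] in auto)
  then show "prob {\<omega>\<in>space M. J \<omega> t = c} = matrix_exp (t *\<^sub>R A) $ i $ c"
    using ctmc_two_times[of 0 t i c] t one by simp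
qed

end

text \<open>Dominated convergence for indicators.\<close>

lemma (in finite_measure) measure_tendsto_zero:
  assumes A: "\<And>n::nat. A n \<in> sets M"
    and ev: "AE \<omega> in M. eventually (\<lambda>n. \<omega> \<notin> A n) sequentially"
  shows "(\<lambda>n. measure M (A n)) \<longlonglongrightarrow> 0"
proof -
  have "(\<lambda>n. \<integral>\<omega>. indicat_real (A n) \<omega> \<partial>M) \<longlonglongrightarrow> (\<integral>\<omega>. 0 \<partial>M)"
  proof (rule integral_dominated_convergence[where w="\<lambda>_. 1"])
    show "AE \<omega> in M. (\<lambda>n. indicat_real (A n) \<omega>) \<longlonglongrightarrow> 0"
      using ev
    proof eventually_elim
      fix \<omega> assume "eventually (\<lambda>n. \<omega> \<notin> A n) sequentially"
      then show "(\<lambda>n. indicat_real (A n) \<omega>) \<longlonglongrightarrow> 0"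
        by (intro tendsto_eventually) (auto elim: eventually_mono)
    qed
  qed (use A in \<open>auto simp: indicator_def\<close>)
  then show ?thesis using A sets.sets_into_space by (simp add: Int_absorb2)
qed

text \<open>A chain started in \<open>i\<close> whose visits to \<open>i\<close> are bounded in time is eventually not in \<open>i\<close>.\<close>

lemma transient_return_tendsto_zero:
  assumes trans: "transient_state A i" and P: "ctmc P (\<lambda>w. w) A (axis i 1)"
  shows "(\<lambda>n. matrix_exp (real n *\<^sub>R A) $ i $ i) \<longlonglongrightarrow> 0"
proof -
  interpret prob_space P using P by (rule ctmc_prob_space)
  have "AE w in P. bdd_above {t. 0 \<le> t \<and> w t = i}"
    using trans P unfolding transient_state_def by blast
  then have "AE w in P. eventually (\<lambda>n. w \<notin> {w\<in>space P. w (real n) = i}) sequentially"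
  proof eventually_elim
    fix w :: "real \<Rightarrow> _" assume "bdd_above {t. 0 \<le> t \<and> w t = i}"
    then obtain K :: real where K: "\<And>t. 0 \<le> t \<Longrightarrow> w t = i \<Longrightarrow> t \<le> K"
      unfolding bdd_above_def by auto
    obtain N :: nat where "K < real N" using reals_Archimedean2 by blast
    show "eventually (\<lambda>n. w \<notin> {w\<in>space P. w (real n) = i}) sequentially"
    proof (rule eventually_sequentiallyI[of N])
      fix n assume "N \<le> n"
      with \<open>K < real N\<close> K[of "real n"] show "w \<notin> {w\<in>space P. w (real n) = i}" by auto
    qed
  qed
  then have "(\<lambda>n. prob {w\<in>space P. w (real n) = i}) \<longlonglongrightarrow> 0"
    by (intro measure_tendsto_zero ctmc_sets[OF P]) auto
  then show ?thesis
    by (simp add: ctmc_start(2)[OF P refl])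
qed

lemma absorbing_matrix_exp:
  "matrix_exp (t *\<^sub>R absorbing_generator Q) $ None $ c = (if c = None then 1 else 0)"
  by (subst matrix_exp_zero_row) (auto simp: absorbing_generator_def)

text \<open>The row of \<open>None\<close> in the generator vanishes, so for each pair of times a return from \<open>None\<close> is a
  null event.\<close>

lemma AE_absorbed:
  assumes chain: "ctmc M J (absorbing_generator Q) \<nu>"
  shows "AE \<omega> in M. absorbed (J \<omega>)"
proof -
  interpret prob_space M using chain by (rule ctmc_prob_space)
  have "AE \<omega> in M. 0 \<le> s \<longrightarrow> s \<le> t \<longrightarrow> J \<omega> s = None \<longrightarrow> J \<omega> t = None" for s t
  proof (cases "0 \<le> s \<and> s \<le> t")
    case True
    have "AE \<omega> in M. \<not> (J \<omega> s = None \<and> J \<omega> t = Some j)" for j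
    proof -
      have "prob {\<omega>\<in>space M. J \<omega> s = None \<and> J \<omega> t = Some j} = 0"
        using ctmc_two_times[OF chain, of s t] True by (simp add: absorbing_matrix_exp)
      moreover have "{\<omega>\<in>space M. J \<omega> s = None \<and> J \<omega> t = Some j} \<in> events"
        using ctmc_measurable[OF chain, of s] ctmc_measurable[OF chain, of t] True by auto
      ultimately show ?thesis by (subst (asm) prob_eq_0) auto
    qed
    then have "AE \<omega> in M. \<forall>j. \<not> (J \<omega> s = None \<and> J \<omega> t = Some j)"
      unfolding AE_all_countable by blast
    then show ?thesis by eventually_elim auto
  qed auto
  then have "AE \<omega> in M. \<forall>s\<in>\<rat>. \<forall>t\<in>\<rat>. 0 \<le> s \<longrightarrow> s \<le> t \<longrightarrow> J \<omega> s = None \<longrightarrow> J \<omega> t = None"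
    by (simp add: AE_ball_countable countable_rat)
  then show ?thesis
    using AE_space by eventually_elim (intro absorbed_if_rational ctmc_right_cont[OF chain]; blast)
qed

section \<open>Phase-type lifetimes\<close>

text \<open>Transience is a statement about chains on path space, so the locale carries such a chain \<open>P i\<close> for
  each starting state; the law of \<^const>\<open>lifetime\<close> under \<open>P i\<close> is then \<open>PH(Q, e\<^sub>i)\<close>. The chains of interest
  live on other probability spaces and are compared with the \<open>P i\<close> through their common transition
  probabilities.\<close>

locale transient_generator =
  fixes Q :: "real^'m^('m::finite)" and P :: "'m \<Rightarrow> (real \<Rightarrow> 'm option) measure"
  assumes transient: "transient_state (absorbing_generator Q) (Some i)"
    and paths: "ctmc (P i) (\<lambda>w. w) (absorbing_generator Q) (axis (Some i) 1)"
begin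

abbreviation trans_prob :: "real \<Rightarrow> 'm option \<Rightarrow> 'm option \<Rightarrow> real" where
  "trans_prob t a c \<equiv> matrix_exp (t *\<^sub>R absorbing_generator Q) $ a $ c"

text \<open>Transience only says that the probability \<open>p\<^sub>j\<^sub>j(t)\<close> of being back in the starting state tends to 0;
  the pigeonhole principle makes this enough. With \<open>m\<close> transient states, a chain that is never
  absorbed is, for each \<open>n\<close>, in the same state at two of the times \<open>0, n, \<dots>, m * n\<close>. By the Markov property the
  probability of this is at most the sum of \<open>p\<^sub>j\<^sub>j((l - k) * n)\<close> over \<open>k < l \<le> m\<close> and \<open>j\<close>, which vanishes
  as \<open>n\<close> grows.\<close>

lemma AE_absorption_finite:
  assumes chain: "ctmc M J (absorbing_generator Q) \<nu>"
  shows "AE \<omega> in M. absorption_time (J \<omega>) < \<infinity>"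
proof -
  interpret prob_space M using chain by (rule ctmc_prob_space)
  let ?m = "CARD('m)"
  let ?K = "{(k, l). k < l \<and> l \<le> ?m} \<times> (UNIV :: 'm set)"
  let ?E = "\<lambda>n ((k, l), j). {\<omega>\<in>space M. J \<omega> (real (k * n)) = Some j \<and> J \<omega> (real (l * n)) = Some j}"
  let ?p = "\<lambda>n ((k, l), j). \<bar>trans_prob (real ((l - k) * n)) (Some j) (Some j)\<bar>"
  \<comment> \<open>Never seeing \<open>None\<close> at integer times is a measurable event that contains non-absorption.\<close>
  define B where "B = {\<omega>\<in>space M. \<forall>n. J \<omega> (real n) \<noteq> None}"
  have "{(k, l). k < l \<and> l \<le> ?m} \<subseteq> {..?m} \<times> {..?m}" by auto
  then have fin: "finite ?K" by (simp add: finite_subset)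
  have meas: "(\<lambda>\<omega>. J \<omega> (real n)) \<in> M \<rightarrow>\<^sub>M count_space UNIV" for n
    using ctmc_measurable[OF chain] by simp
  have B: "B \<in> events"
    unfolding B_def using meas by measurable
  have bound: "prob B \<le> (\<Sum>c\<in>?K. ?p n c)" for n
  proof -
    have "{\<omega>\<in>space M. J \<omega> (real k) = Some j \<and> J \<omega> (real l) = Some j} \<in> events" for k l j
      using meas[of k] meas[of l] by auto
    then have ev: "?E n c \<in> events" for c
      by (simp add: case_prod_beta del: of_nat_mult)
    have "B \<subseteq> (\<Union>c\<in>?K. ?E n c)"
    proof
      fix \<omega> assume \<omega>: "\<omega> \<in> B"
      let ?f = "\<lambda>k. the (J \<omega> (real (k * n)))"
      \<comment> \<open>On \<open>B\<close> the chain is in \<open>E\<close> at each of the \<open>?m + 1\<close> times \<open>0, n, \<dots>, ?m * n\<close>, one more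
        than there are states.\<close>
      have "\<not> inj_on ?f {..?m}"
      proof
        assume "inj_on ?f {..?m}"
        then have "card {..?m} \<le> ?m" by (rule card_inj_on_le) auto
        then show False by simp
      qed
      then obtain k l where kl: "k < l" "l \<le> ?m" "?f k = ?f l"
        unfolding inj_on_def by (metis atMost_iff linorder_neqE_nat)
      have f: "J \<omega> (real (i * n)) = Some (?f i)" for i
        using \<omega> unfolding B_def by (simp del: of_nat_mult)
      have "J \<omega> (real (k * n)) = Some (?f k)" "J \<omega> (real (l * n)) = Some (?f k)"
        using f[of k] f[of l] unfolding kl(3) by -
      moreover have "((k, l), ?f k) \<in> ?K" using kl by simp
      moreover have "\<omega> \<in> space M" using \<omega> unfolding B_def by simp
      ultimately have "\<omega> \<in> ?E n ((k, l), ?f k)" "((k, l), ?f k) \<in> ?K"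
        by (simp_all del: of_nat_mult)
      then show "\<omega> \<in> (\<Union>c\<in>?K. ?E n c)" by blast
    qed
    then have "prob B \<le> prob (\<Union>c\<in>?K. ?E n c)"
      by (intro finite_measure_mono) (use fin ev in auto)
    also have "\<dots> \<le> (\<Sum>c\<in>?K. prob (?E n c))"
      by (rule finite_measure_subadditive_finite) (use fin ev in auto)
    also have "\<dots> \<le> (\<Sum>c\<in>?K. ?p n c)"
    proof (rule sum_mono)
      fix c assume "c \<in> ?K"
      then obtain k l j where c: "c = ((k, l), j)" "k < l" by auto
      have "prob (?E n c) = prob {\<omega>\<in>space M. J \<omega> (real (k * n)) = Some j}
          * trans_prob (real (l * n) - real (k * n)) (Some j) (Some j)"
        using c unfolding c(1) split
        by (intro ctmc_two_times[OF chain]) (auto intro: mult_right_mono)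
      also have "real (l * n) - real (k * n) = real ((l - k) * n)"
        using c by (simp add: of_nat_diff algebra_simps)
      finally have "prob (?E n c) = prob {\<omega>\<in>space M. J \<omega> (real (k * n)) = Some j}
          * trans_prob (real ((l - k) * n)) (Some j) (Some j)" .
      also have "\<dots> \<le> 1 * \<bar>trans_prob (real ((l - k) * n)) (Some j) (Some j)\<bar>"
        by (rule order_trans[OF mult_left_mono[OF abs_ge_self] mult_right_mono]) auto
      finally show "prob (?E n c) \<le> ?p n c" by (simp add: c)
    qed
    finally show ?thesis .
  qed
  have "(\<lambda>n. \<Sum>c\<in>?K. ?p n c) \<longlonglongrightarrow> (\<Sum>c\<in>?K. 0)"
  proof (rule tendsto_sum)
    fix c assume "c \<in> ?K"
    then obtain k l j where c: "c = ((k, l), j)" "k < l" by auto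
    have "strict_mono (\<lambda>n. (l - k) * n)"
      using c(2) by (simp add: strict_mono_def)
    from LIMSEQ_subseq_LIMSEQ[OF transient_return_tendsto_zero[OF transient paths] this, of j]
    show "(\<lambda>n. ?p n c) \<longlonglongrightarrow> 0"
      unfolding c(1) split o_def by (rule tendsto_rabs_zero)
  qed
  then have "prob B \<le> 0"
    by (intro LIMSEQ_le_const[of "\<lambda>n. \<Sum>c\<in>?K. ?p n c"]) (use bound in auto)
  then have "prob B = 0" using measure_nonneg[of M B] by linarith
  then have "AE \<omega> in M. \<omega> \<notin> B" using B by (simp add: prob_eq_0)
  then show ?thesis
    using AE_space
  proof eventually_elim
    fix \<omega> assume "\<omega> \<notin> B" "\<omega> \<in> space M"
    then obtain n where "J \<omega> (real n) = None" unfolding B_def by auto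
    then have "absorption_time (J \<omega>) \<le> ereal (real n)"
      unfolding absorption_time_def by (intro INF_lower) auto
    then show "absorption_time (J \<omega>) < \<infinity>"
      by (rule le_less_trans) simp
  qed
qed

text \<open>Lifetimes are almost surely finite and \<open>None\<close> is almost surely never left. This reduces every question about the lifetime to the state of the chain at fixed times.\<close>

lemma AE_lifetime_le_iff:
  assumes chain: "ctmc M J (absorbing_generator Q) \<nu>"
  shows "AE \<omega> in M. \<forall>t\<ge>0. lifetime (J \<omega>) \<le> t \<longleftrightarrow> J \<omega> t = None"
  using AE_absorption_finite[OF chain] AE_absorbed[OF chain] AE_space
proof eventually_elim
  fix \<omega> assume *: "absorption_time (J \<omega>) < \<infinity>" "absorbed (J \<omega>)" "\<omega> \<in> space M"
  have "ereal (lifetime (J \<omega>)) = absorption_time (J \<omega>)"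
    unfolding lifetime_def using *(1) absorption_time_nonneg[of "J \<omega>"]
    by (auto simp: ereal_real)
  then have "lifetime (J \<omega>) \<le> t \<longleftrightarrow> absorption_time (J \<omega>) \<le> ereal t" for t
    by (metis ereal_less_eq(3))
  then show "\<forall>t\<ge>0. lifetime (J \<omega>) \<le> t \<longleftrightarrow> J \<omega> t = None"
    using absorption_time_le_iff[OF ctmc_right_cont[OF chain *(3)] *(2)] by simp
qed

lemma borel_measurable_lifetime:
  assumes chain: "ctmc M J (absorbing_generator Q) \<nu>"
  shows "(\<lambda>\<omega>. lifetime (J \<omega>)) \<in> borel_measurable M"
  unfolding lifetime_def
  using borel_measurable_absorption_time[OF ctmc_measurable[OF chain] ctmc_right_cont[OF chain]]
  by simp

text \<open>A right-continuous path that starts in \<open>Some i\<close> stays there for a while.\<close>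

lemma immediate_exit_tendsto_zero:
  "(\<lambda>n. trans_prob (1 / real (Suc n)) (Some i) None) \<longlonglongrightarrow> 0"
proof -
  interpret prob_space "P i" using paths by (rule ctmc_prob_space)
  have "AE w in P i. w 0 = Some i"
    by (rule ctmc_start(1)[OF paths refl, of 0]) simp
  then have "AE w in P i. eventually (\<lambda>n. w \<notin> {w\<in>space (P i). w (1 / real (Suc n)) = None}) sequentially"
    using AE_space
  proof eventually_elim
    fix w assume w: "w 0 = Some i" "w \<in> space (P i)"
    obtain e where e: "0 < e" "\<And>u. 0 \<le> u \<Longrightarrow> u < 0 + e \<Longrightarrow> w u = w 0"
      using right_cont_pathE[OF ctmc_right_cont[OF paths w(2)], of 0] by blast
    have "eventually (\<lambda>n. 1 / real (Suc n) < e) sequentially"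
      using e(1) LIMSEQ_inverse_real_of_nat by (auto simp: inverse_eq_divide dest: order_tendstoD(2))
    then show "eventually (\<lambda>n. w \<notin> {w\<in>space (P i). w (1 / real (Suc n)) = None}) sequentially"
    proof eventually_elim
      case (elim n)
      then show ?case using e(2)[of "1 / real (Suc n)"] w(1) by simp
    qed
  qed
  then have "(\<lambda>n. prob {w\<in>space (P i). w (1 / real (Suc n)) = None}) \<longlonglongrightarrow> 0"
    by (intro measure_tendsto_zero ctmc_sets[OF paths]) auto
  then show ?thesis
    by (simp add: ctmc_start(2)[OF paths refl] del: of_nat_Suc)
qed

text \<open>Phase-type laws have no atoms away from 0. An atom at \<open>v\<close> would force absorption within each of the
  short intervals that end at \<open>v\<close>, but the chance of that tends to 0 with the length of the interval,
  uniformly in the state at its beginning.\<close>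

lemma AE_lifetime_neq:
  assumes chain: "ctmc M J (absorbing_generator Q) \<nu>" and v: "0 < v"
  shows "AE \<omega> in M. lifetime (J \<omega>) \<noteq> v"
proof -
  interpret prob_space M using chain by (rule ctmc_prob_space)
  note [measurable] = borel_measurable_lifetime[OF chain]
  let ?B = "{\<omega>\<in>space M. lifetime (J \<omega>) = v}"
  have "eventually (\<lambda>n. 1 / real (Suc n) < v) sequentially"
    using v LIMSEQ_inverse_real_of_nat by (auto simp: inverse_eq_divide dest: order_tendstoD(2))
  \<comment> \<open>Dying exactly at \<open>v\<close> means being alive at \<open>v - 1 / (n + 1)\<close> and dead at \<open>v\<close>.\<close>
  then have "eventually (\<lambda>n. prob ?B \<le> (\<Sum>i\<in>UNIV. \<bar>trans_prob (1 / real (Suc n)) (Some i) None\<bar>)) sequentially"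
  proof eventually_elim
    case (elim n)
    let ?e = "1 / real (Suc n)"
    let ?E = "\<lambda>i. {\<omega>\<in>space M. J \<omega> (v - ?e) = Some i \<and> J \<omega> v = None}"
    have e: "0 < ?e" by simp
    have E: "?E i \<in> events" for i
      using ctmc_measurable[OF chain, of v] ctmc_measurable[OF chain, of "v - ?e"] elim v by auto
    have "AE \<omega> in M. \<omega> \<in> ?B \<longrightarrow> \<omega> \<in> (\<Union>i. ?E i)"
      using AE_lifetime_le_iff[OF chain] AE_space
    proof eventually_elim
      fix \<omega> assume *: "\<forall>t\<ge>0. lifetime (J \<omega>) \<le> t \<longleftrightarrow> J \<omega> t = None" "\<omega> \<in> space M"
      show "\<omega> \<in> ?B \<longrightarrow> \<omega> \<in> (\<Union>i. ?E i)"
      proof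
        assume "\<omega> \<in> ?B"
        then have "J \<omega> v = None" "J \<omega> (v - ?e) \<noteq> None"
          using *(1)[rule_format, of v] *(1)[rule_format, of "v - ?e"] elim v e by auto
        then show "\<omega> \<in> (\<Union>i. ?E i)" using *(2) by auto
      qed
    qed
    then have "prob ?B \<le> prob (\<Union>i. ?E i)"
      by (rule finite_measure_mono_AE) (use E in auto)
    also have "\<dots> \<le> (\<Sum>i\<in>UNIV. prob (?E i))"
      by (rule finite_measure_subadditive_finite) (use E in auto)
    also have "\<dots> \<le> (\<Sum>i\<in>UNIV. \<bar>trans_prob ?e (Some i) None\<bar>)"
    proof (rule sum_mono)
      fix i
      have "prob (?E i) = prob {\<omega>\<in>space M. J \<omega> (v - ?e) = Some i} * trans_prob (v - (v - ?e)) (Some i) None"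
        by (rule ctmc_two_times[OF chain]) (use elim e in linarith)+
      also have "v - (v - ?e) = ?e" by simp
      also have "prob {\<omega>\<in>space M. J \<omega> (v - ?e) = Some i} * trans_prob ?e (Some i) None
          \<le> 1 * \<bar>trans_prob ?e (Some i) None\<bar>"
        by (rule order_trans[OF mult_left_mono[OF abs_ge_self] mult_right_mono]) auto
      finally show "prob (?E i) \<le> \<bar>trans_prob ?e (Some i) None\<bar>" by simp
    qed
    finally show ?case .
  qed
  moreover have "(\<lambda>n. \<Sum>i\<in>UNIV. \<bar>trans_prob (1 / real (Suc n)) (Some i) None\<bar>) \<longlonglongrightarrow> (\<Sum>i\<in>(UNIV::'m set). 0)"
    by (intro tendsto_sum tendsto_rabs_zero immediate_exit_tendsto_zero)
  ultimately have "prob ?B \<le> 0"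
    by (intro tendsto_lowerbound[of "\<lambda>n. \<Sum>i\<in>UNIV. \<bar>trans_prob (1 / real (Suc n)) (Some i) None\<bar>"]) auto
  then have "prob ?B = 0" using measure_nonneg[of M ?B] by linarith
  then show ?thesis by (subst (asm) prob_eq_0) auto
qed

text \<open>The Markov property at the fixed time \<open>v\<close>: given the phase \<open>i\<close>, the remaining lifetime has the law
  \<open>PH(Q, e\<^sub>i)\<close>. The distribution function of either law at \<open>r \<ge> 0\<close> is the transition probability from
  \<open>Some i\<close> to \<open>None\<close> in time \<open>r\<close>.\<close>

lemma residual_lifetime:
  assumes chain: "ctmc M J (absorbing_generator Q) \<nu>" and v: "0 \<le> v"
    and h: "h \<in> borel_measurable borel"
  shows "(\<integral>\<^sup>+\<omega>. indicator {\<omega>. J \<omega> v = Some i} \<omega> * h (lifetime (J \<omega>) - v) \<partial>M)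
       = emeasure M {\<omega>\<in>space M. J \<omega> v = Some i} * (\<integral>\<^sup>+w. h (lifetime w) \<partial>P i)"
proof -
  interpret prob_space M using chain by (rule ctmc_prob_space)
  interpret Pi: prob_space "P i" using paths by (rule ctmc_prob_space)
  note [measurable] = borel_measurable_lifetime[OF chain] borel_measurable_lifetime[OF paths] h
  let ?A = "{\<omega>\<in>space M. J \<omega> v = Some i}"
  have A[measurable]: "?A \<in> events" by (rule ctmc_sets[OF chain v])
  \<comment> \<open>Both sides are integrals of \<open>h\<close>, against the law of the residual lifetime restricted to
    \<open>?A\<close> and against a multiple of \<open>PH(Q, e\<^sub>i)\<close>; so it suffices to compare distribution functions.\<close>
  let ?\<mu> = "distr (density M (indicator ?A)) borel (\<lambda>\<omega>. lifetime (J \<omega>) - v)"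
  let ?\<nu> = "scale_measure (emeasure M ?A) (distr (P i) borel lifetime)"
  have mu: "emeasure ?\<mu> X = emeasure M {\<omega>\<in>space M. J \<omega> v = Some i \<and> lifetime (J \<omega>) - v \<in> X}"
    if [measurable]: "X \<in> sets borel" for X
  proof -
    have "emeasure ?\<mu> X = (\<integral>\<^sup>+\<omega>. indicator ?A \<omega> * indicator ((\<lambda>\<omega>. lifetime (J \<omega>) - v) -` X \<inter> space M) \<omega> \<partial>M)"
      by (simp add: emeasure_distr emeasure_density)
    also have "\<dots> = (\<integral>\<^sup>+\<omega>. indicator {\<omega>\<in>space M. J \<omega> v = Some i \<and> lifetime (J \<omega>) - v \<in> X} \<omega> \<partial>M)"
      by (intro nn_integral_cong) (auto simp: indicator_def)
    also have "\<dots> = emeasure M {\<omega>\<in>space M. J \<omega> v = Some i \<and> lifetime (J \<omega>) - v \<in> X}"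
      using A by (intro nn_integral_indicator) measurable
    finally show ?thesis .
  qed
  have "?\<mu> = ?\<nu>"
  proof (rule cdf_unique')
    show "finite_borel_measure ?\<mu>"
      unfolding finite_borel_measure_def finite_borel_measure_axioms_def
      by (auto intro!: finite_measureI simp: mu)
    show "finite_borel_measure ?\<nu>"
      unfolding finite_borel_measure_def finite_borel_measure_axioms_def
      by (auto intro!: finite_measureI simp: ennreal_mult_eq_top_iff emeasure_distr space_scale_measure)
    show "cdf ?\<mu> = cdf ?\<nu>"
    proof
      fix r
      show "cdf ?\<mu> r = cdf ?\<nu> r"
      proof (cases "0 \<le> r")
        case True
        have "AE \<omega> in M. (J \<omega> v = Some i \<and> lifetime (J \<omega>) - v \<in> {..r})
             \<longleftrightarrow> (J \<omega> v = Some i \<and> J \<omega> (v + r) = None)"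
          using AE_lifetime_le_iff[OF chain]
        proof eventually_elim
          fix \<omega> assume "\<forall>t\<ge>0. lifetime (J \<omega>) \<le> t \<longleftrightarrow> J \<omega> t = None"
          from this[rule_format, of "v + r"] show "(J \<omega> v = Some i \<and> lifetime (J \<omega>) - v \<in> {..r})
             \<longleftrightarrow> (J \<omega> v = Some i \<and> J \<omega> (v + r) = None)"
            using True v by (auto simp: algebra_simps)
        qed
        then have "prob {\<omega>\<in>space M. J \<omega> v = Some i \<and> lifetime (J \<omega>) - v \<in> {..r}}
            = prob {\<omega>\<in>space M. J \<omega> v = Some i \<and> J \<omega> (v + r) = None}"
          by (intro finite_measure_eq_AE)
             (use ctmc_measurable[OF chain, of v] ctmc_measurable[OF chain, of "v + r"] True v in auto)
        also have "\<dots> = prob ?A * trans_prob r (Some i) None"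
          using ctmc_two_times[OF chain, of v "v + r" "Some i" None] True v by simp
        also have "trans_prob r (Some i) None = Pi.prob {w\<in>space (P i). w r = None}"
          using ctmc_start(2)[OF paths refl True] by simp
        also have "\<dots> = Pi.prob {w\<in>space (P i). lifetime w \<le> r}"
        proof (rule Pi.finite_measure_eq_AE)
          show "AE w in P i. w \<in> {w\<in>space (P i). w r = None} \<longleftrightarrow> w \<in> {w\<in>space (P i). lifetime w \<le> r}"
            using AE_lifetime_le_iff[OF paths] by eventually_elim (use True in auto)
        qed (use ctmc_sets[OF paths True] in auto)
        also have "\<dots> = measure (distr (P i) borel lifetime) {..r}"
          by (subst measure_distr) (auto intro!: arg_cong[where f="measure (P i)"])
        finally show ?thesis
          by (simp add: cdf_def measure_def mu enn2real_mult)
      next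
        case False
        have "AE \<omega> in M. J \<omega> v = Some i \<longrightarrow> v < lifetime (J \<omega>)"
          using AE_lifetime_le_iff[OF chain] by eventually_elim (use v in \<open>auto simp: not_le[symmetric]\<close>)
        then have "prob {\<omega>\<in>space M. J \<omega> v = Some i \<and> lifetime (J \<omega>) - v \<in> {..r}} = prob {}"
          by (intro finite_measure_eq_AE) (use False ctmc_measurable[OF chain v] in auto)
        moreover have "lifetime -` {..r} = ({} :: (real \<Rightarrow> 'm option) set)"
          using False order_trans[OF lifetime_nonneg] by (auto simp: not_le dest: order_less_le_trans order_trans)
        then have "emeasure (distr (P i) borel lifetime) {..r} = 0"
          by (simp add: emeasure_distr)
        ultimately show ?thesis
          by (simp add: cdf_def measure_def mu)
      qed
    qed
  qed
  have "(\<integral>\<^sup>+\<omega>. indicator {\<omega>. J \<omega> v = Some i} \<omega> * h (lifetime (J \<omega>) - v) \<partial>M)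
      = (\<integral>\<^sup>+\<omega>. indicator ?A \<omega> * h (lifetime (J \<omega>) - v) \<partial>M)"
    by (intro nn_integral_cong) (auto simp: indicator_def)
  also have "\<dots> = (\<integral>\<^sup>+r. h r \<partial>?\<mu>)"
    by (simp add: nn_integral_distr nn_integral_density)
  also have "\<dots> = emeasure M ?A * (\<integral>\<^sup>+w. h (lifetime w) \<partial>P i)"
    unfolding \<open>?\<mu> = ?\<nu>\<close> by (simp add: nn_integral_scale_measure nn_integral_distr)
  finally show ?thesis .
qed

end

section \<open>Chains observed at an independent time\<close>

text \<open>The information in a process, packaged as a measurable space so that it can serve as a
  factor of a product space.\<close>

definition process_algebra :: "'w measure \<Rightarrow> ('w \<Rightarrow> real \<Rightarrow> 's) \<Rightarrow> 'w measure" where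
  "process_algebra M J = vimage_algebra (space M)
     (\<lambda>\<omega>. restrict (J \<omega>) {0..}) (PiM {0..} (\<lambda>_. count_space UNIV))"

lemma sets_process_algebra: "sets (process_algebra M J) = process_sigma M J"
  by (simp add: process_algebra_def process_sigma_def)

lemma space_process_algebra [simp]: "space (process_algebra M J) = space M"
  by (simp add: process_algebra_def)

lemma measurable_process_algebra:
  assumes "0 \<le> t"
  shows "(\<lambda>\<omega>. J \<omega> t) \<in> process_algebra M J \<rightarrow>\<^sub>M count_space UNIV"
proof -
  have "(\<lambda>\<omega>. restrict (J \<omega>) {0..} t) \<in> process_algebra M J \<rightarrow>\<^sub>M count_space UNIV"
    unfolding process_algebra_def
  proof (rule measurable_compose[OF measurable_vimage_algebra1 measurable_component_singleton])
    show "(\<lambda>\<omega>. restrict (J \<omega>) {0..}) \<in> space M \<rightarrow> space (PiM {0..} (\<lambda>_. count_space UNIV))"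
      using restrict_extensional by (auto simp: space_PiM PiE_def)
  qed (use assms in simp)
  then show ?thesis using assms by simp
qed

text \<open>The state at time \<open>t\<close> is the limit of the states at grid points decreasing to \<open>t\<close>, and at grid points,
  which are countable in number, time and chance can be separated.\<close>

lemma measurable_right_cont_process:
  assumes J: "\<And>t. 0 \<le> t \<Longrightarrow> (\<lambda>\<omega>. J \<omega> t) \<in> F \<rightarrow>\<^sub>M count_space UNIV"
    and rc: "\<And>\<omega>. \<omega> \<in> space F \<Longrightarrow> right_cont_path (J \<omega>)"
  shows "Measurable.pred (borel \<Otimes>\<^sub>M F) (\<lambda>p. 0 < fst p \<and> J (snd p) (fst p) = a)"
proof -
  \<comment> \<open>The point \<open>q n t\<close> is the first point after \<open>t\<close> on the grid of mesh \<open>1 / (n + 1)\<close>.\<close>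
  define q where "q n t = (real_of_int \<lfloor>real (Suc n) * t\<rfloor> + 1) / real (Suc n)" for n t
  have q: "t < q n t" "q n t \<le> t + 1 / real (Suc n)" for n t
    unfolding q_def by (simp_all add: field_simps del: of_nat_Suc) linarith+
  have "(\<lambda>p. J (snd p) (max 0 ((real_of_int k + 1) / real (Suc n)))) \<in> borel \<Otimes>\<^sub>M F \<rightarrow>\<^sub>M count_space UNIV" for n k
    by (rule measurable_compose[OF measurable_snd J]) simp
  \<comment> \<open>The truncation at 0 keeps the grid points in the time domain also for negative first
    components, which the predicate excludes.\<close>
  then have [measurable]: "(\<lambda>p. J (snd p) (max 0 (q n (fst p)))) \<in> borel \<Otimes>\<^sub>M F \<rightarrow>\<^sub>M count_space UNIV" for n
    unfolding q_def
    by (rule measurable_compose_countable[where g="\<lambda>p. \<lfloor>real (Suc n) * fst p\<rfloor>"]) measurable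
  have "(0 < fst p \<and> J (snd p) (fst p) = a) \<longleftrightarrow>
      (0 < fst p \<and> (\<exists>N. \<forall>n\<ge>N. J (snd p) (max 0 (q n (fst p))) = a))"
    if "p \<in> space (borel \<Otimes>\<^sub>M F)" for p
  proof (rule conj_cong[OF refl])
    assume t: "0 < fst p"
    let ?t = "fst p" and ?w = "J (snd p)"
    have "right_cont_path ?w" using that rc by (auto simp: space_pair_measure)
    then obtain e where e: "0 < e" "\<And>u. ?t \<le> u \<Longrightarrow> u < ?t + e \<Longrightarrow> ?w u = ?w ?t"
      using right_cont_pathE[of ?w ?t] t by (metis less_imp_le)
    have "eventually (\<lambda>n. 1 / real (Suc n) < e) sequentially"
      using e(1) LIMSEQ_inverse_real_of_nat by (auto simp: inverse_eq_divide dest: order_tendstoD(2))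
    then have "eventually (\<lambda>n. ?w (max 0 (q n ?t)) = ?w ?t) sequentially"
    proof eventually_elim
      case (elim n)
      with e(2)[of "q n ?t"] q[where t="?t" and n=n] t show ?case by simp
    qed
    then obtain N0 where N0: "\<And>n. N0 \<le> n \<Longrightarrow> ?w (max 0 (q n ?t)) = ?w ?t"
      unfolding eventually_sequentially by blast
    show "?w ?t = a \<longleftrightarrow> (\<exists>N. \<forall>n\<ge>N. ?w (max 0 (q n ?t)) = a)"
    proof
      assume "\<exists>N. \<forall>n\<ge>N. ?w (max 0 (q n ?t)) = a"
      then obtain N where "\<forall>n\<ge>N. ?w (max 0 (q n ?t)) = a" ..
      then show "?w ?t = a" using N0[of "max N N0"] by simp
    qed (use N0 in metis)
  qed
  then show ?thesis
    by (subst measurable_cong[OF]) measurable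
qed

text \<open>Fubini's theorem for a parameter \<open>W\<close> that is independent of the information \<open>F\<close>: the joint law of
  \<open>W\<close> and of the identity map into \<open>F\<close> is a product measure, so the parameter can be frozen. Working with \<open>F\<close> in place of
  a random element lets the integrand depend on a whole path.\<close>

lemma (in prob_space) nn_integral_indep_parameter:
  assumes W[measurable]: "random_variable borel W"
    and F: "space F = space M" "sets F \<subseteq> events"
    and indep: "indep_set (variable_sigma M W) (sets F)"
    and f[measurable]: "f \<in> borel_measurable (borel \<Otimes>\<^sub>M F)"
  shows "(\<integral>\<^sup>+\<omega>. f (W \<omega>, \<omega>) \<partial>M) = (\<integral>\<^sup>+\<omega>. (\<integral>\<^sup>+\<omega>'. f (W \<omega>, \<omega>') \<partial>M) \<partial>M)"
proof -
  have vimage: "(\<lambda>\<omega>. \<omega>) -` A \<inter> space M = A" if "A \<in> sets F" for A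
    using sets.sets_into_space[OF that] F(1) by auto
  have id[measurable]: "(\<lambda>\<omega>. \<omega>) \<in> M \<rightarrow>\<^sub>M F"
    using F vimage by (intro measurableI) auto
  interpret W: prob_space "distr M borel W" by (rule prob_space_distr) simp
  interpret F: prob_space "distr M F (\<lambda>\<omega>. \<omega>)" by (rule prob_space_distr) simp
  have distr: "distr M borel W \<Otimes>\<^sub>M distr M F (\<lambda>\<omega>. \<omega>) = distr M (borel \<Otimes>\<^sub>M F) (\<lambda>\<omega>. (W \<omega>, \<omega>))"
  proof (rule pair_measure_eqI)
    fix A B assume "A \<in> sets (distr M borel W)" "B \<in> sets (distr M F (\<lambda>\<omega>. \<omega>))"
    then have AB[measurable]: "A \<in> sets borel" "B \<in> sets F" by simp_all
    have "W -` A \<inter> space M \<in> variable_sigma M W"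
      using AB(1) by (auto simp: variable_sigma_def intro: in_vimage_algebra)
    then have "prob ((W -` A \<inter> space M) \<inter> B) = prob (W -` A \<inter> space M) * prob B"
      using AB(2) by (intro indep_setD[OF indep])
    moreover have "(\<lambda>\<omega>. (W \<omega>, \<omega>)) -` (A \<times> B) \<inter> space M = (W -` A \<inter> space M) \<inter> B"
      using vimage[OF AB(2)] by auto
    ultimately show "emeasure (distr M borel W) A * emeasure (distr M F (\<lambda>\<omega>. \<omega>)) B
        = emeasure (distr M (borel \<Otimes>\<^sub>M F) (\<lambda>\<omega>. (W \<omega>, \<omega>))) (A \<times> B)"
      using vimage[OF AB(2)] by (simp add: emeasure_distr AB emeasure_eq_measure ennreal_mult)
  qed (auto intro: W.sigma_finite_measure F.sigma_finite_measure)
  have "(\<integral>\<^sup>+\<omega>. f (W \<omega>, \<omega>) \<partial>M) = (\<integral>\<^sup>+p. f p \<partial>(distr M borel W \<Otimes>\<^sub>M distr M F (\<lambda>\<omega>. \<omega>)))"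
    unfolding distr by (subst nn_integral_distr) auto
  also have "\<dots> = (\<integral>\<^sup>+w. (\<integral>\<^sup>+\<omega>'. f (w, \<omega>') \<partial>distr M F (\<lambda>\<omega>. \<omega>)) \<partial>distr M borel W)"
    by (rule F.nn_integral_fst[symmetric]) simp
  also have "\<dots> = (\<integral>\<^sup>+w. (\<integral>\<^sup>+\<omega>'. f (w, \<omega>') \<partial>M) \<partial>distr M borel W)"
    by (intro nn_integral_cong nn_integral_distr) auto
  also have "\<dots> = (\<integral>\<^sup>+\<omega>. (\<integral>\<^sup>+\<omega>'. f (W \<omega>, \<omega>') \<partial>M) \<partial>M)"
  proof (rule nn_integral_distr[OF W])
    have "(\<lambda>w. \<integral>\<^sup>+\<omega>'. f (w, \<omega>') \<partial>distr M F (\<lambda>\<omega>. \<omega>)) \<in> borel_measurable borel"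
      by measurable
    moreover have "(\<integral>\<^sup>+\<omega>'. f (w, \<omega>') \<partial>distr M F (\<lambda>\<omega>. \<omega>)) = (\<integral>\<^sup>+\<omega>'. f (w, \<omega>') \<partial>M)" for w
      by (intro nn_integral_distr) auto
    ultimately show "(\<lambda>w. \<integral>\<^sup>+\<omega>'. f (w, \<omega>') \<partial>M) \<in> borel_measurable (distr M borel W)"
      by simp
  qed
  finally show ?thesis .
qed

lemma ctmc_state_at_measurable:
  assumes chain: "ctmc M J A \<nu>" and [measurable]: "W \<in> borel_measurable M"
  shows "{\<omega>\<in>space M. 0 < W \<omega> \<and> J \<omega> (W \<omega>) = a} \<in> sets M"
proof -
  have "Measurable.pred (borel \<Otimes>\<^sub>M M) (\<lambda>p. 0 < fst p \<and> J (snd p) (fst p) = a)"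
    by (rule measurable_right_cont_process[OF ctmc_measurable[OF chain] ctmc_right_cont[OF chain]])
  from measurable_compose[OF _ this, of "\<lambda>\<omega>. (W \<omega>, \<omega>)" M] show ?thesis
    by (auto simp: pred_def)
qed

context transient_generator
begin

context
  fixes M :: "'w measure" and J :: "'w \<Rightarrow> real \<Rightarrow> 'm option" and \<nu> and W :: "'w \<Rightarrow> real"
  assumes chain: "ctmc M J (absorbing_generator Q) \<nu>"
    and W: "W \<in> borel_measurable M"
    and indep: "prob_space.indep_set M (variable_sigma M W) (process_sigma M J)"
begin

lemma borel_measurable_lifetime_process_algebra:
  "(\<lambda>\<omega>. lifetime (J \<omega>)) \<in> borel_measurable (process_algebra M J)"
  unfolding lifetime_def
  by (intro borel_measurable_real_of_ereal borel_measurable_absorption_time measurable_process_algebra)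
     (use ctmc_right_cont[OF chain] in auto)

lemma nn_integral_indep_clock:
  assumes f: "f \<in> borel_measurable (borel \<Otimes>\<^sub>M process_algebra M J)"
  shows "(\<integral>\<^sup>+\<omega>. f (W \<omega>, \<omega>) \<partial>M) = (\<integral>\<^sup>+\<omega>. (\<integral>\<^sup>+\<omega>'. f (W \<omega>, \<omega>') \<partial>M) \<partial>M)"
proof -
  interpret prob_space M using chain by (rule ctmc_prob_space)
  show ?thesis
    by (rule nn_integral_indep_parameter[OF W, where F="process_algebra M J"])
       (use indep f in \<open>auto simp: sets_process_algebra dest: indep_setD_ev2\<close>)
qed

text \<open>The lifetime has no atoms at positive times, hence it does not hit an independent positive time.\<close>

lemma AE_lifetime_neq_indep: "AE \<omega> in M. 0 < W \<omega> \<longrightarrow> lifetime (J \<omega>) \<noteq> W \<omega>"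
proof -
  interpret prob_space M using chain by (rule ctmc_prob_space)
  note [measurable] = borel_measurable_lifetime_process_algebra borel_measurable_lifetime[OF chain] W
  have "emeasure M {\<omega>\<in>space M. 0 < W \<omega> \<and> lifetime (J \<omega>) = W \<omega>}
      = (\<integral>\<^sup>+\<omega>. indicator {\<omega>\<in>space M. 0 < W \<omega> \<and> lifetime (J \<omega>) = W \<omega>} \<omega> \<partial>M)"
    by (rule nn_integral_indicator[symmetric]) measurable
  also have "\<dots> = (\<integral>\<^sup>+\<omega>. indicator {p. 0 < fst p \<and> lifetime (J (snd p)) = fst p} (W \<omega>, \<omega>) \<partial>M)"
    by (intro nn_integral_cong) (auto simp: indicator_def)
  also have "\<dots> = (\<integral>\<^sup>+\<omega>. (\<integral>\<^sup>+\<omega>'. indicator {p. 0 < fst p \<and> lifetime (J (snd p)) = fst p} (W \<omega>, \<omega>') \<partial>M) \<partial>M)"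
    by (rule nn_integral_indep_clock) measurable
  also have "\<dots> = (\<integral>\<^sup>+\<omega>. 0 \<partial>M)"
  proof (rule nn_integral_cong)
    fix \<omega>
    show "(\<integral>\<^sup>+\<omega>'. indicator {p. 0 < fst p \<and> lifetime (J (snd p)) = fst p} (W \<omega>, \<omega>') \<partial>M) = 0"
    proof (cases "0 < W \<omega>")
      case True
      have "(\<integral>\<^sup>+\<omega>'. indicator {p. 0 < fst p \<and> lifetime (J (snd p)) = fst p} (W \<omega>, \<omega>') \<partial>M) = (\<integral>\<^sup>+\<omega>'. 0 \<partial>M)"
        by (rule nn_integral_cong_AE) (use AE_lifetime_neq[OF chain True] in auto)
      then show ?thesis by simp
    qed simp
  qed
  finally have "{\<omega>\<in>space M. 0 < W \<omega> \<and> lifetime (J \<omega>) = W \<omega>} \<in> null_sets M"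
    by (intro null_setsI) (auto, measurable)
  from AE_not_in[OF this] show ?thesis
    using AE_space by eventually_elim auto
qed

text \<open>The Markov property at an independent positive time \<open>W\<close>. Freezing \<open>W\<close> reduces it to \<open>residual_lifetime\<close>;
  the case \<open>W = lifetime\<close>, in which no phase is occupied at \<open>W\<close>, is negligible because there are no atoms.
  Nonpositive values of \<open>W\<close> mark the outcomes to be ignored.\<close>

lemma overshoot:
  assumes h: "h \<in> borel_measurable borel"
  shows "(\<integral>\<^sup>+\<omega>. indicator {\<omega>. 0 < W \<omega> \<and> W \<omega> \<le> lifetime (J \<omega>)} \<omega> * h (lifetime (J \<omega>) - W \<omega>) \<partial>M)
       = (\<Sum>i\<in>UNIV. (\<integral>\<^sup>+\<omega>. indicator {\<omega>. 0 < W \<omega> \<and> J \<omega> (W \<omega>) = Some i} \<omega> \<partial>M)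
            * (\<integral>\<^sup>+w. h (lifetime w) \<partial>P i))"
proof -
  interpret prob_space M using chain by (rule ctmc_prob_space)
  note [measurable] = borel_measurable_lifetime_process_algebra W h
  have [measurable]: "Measurable.pred (borel \<Otimes>\<^sub>M process_algebra M J) (\<lambda>p. 0 < fst p \<and> J (snd p) (fst p) = a)" for a
    by (rule measurable_right_cont_process) (use measurable_process_algebra ctmc_right_cont[OF chain] in auto)
  let ?p = "\<lambda>i w. indicator {0<..} w * emeasure M {\<omega>\<in>space M. J \<omega> w = Some i} :: ennreal"
  have p: "(\<integral>\<^sup>+\<omega>'. indicator {p. 0 < fst p \<and> J (snd p) (fst p) = Some i} (w, \<omega>') \<partial>M) = ?p i w" for i w
  proof (cases "0 < w")
    case True
    have "(\<integral>\<^sup>+\<omega>'. indicator {p. 0 < fst p \<and> J (snd p) (fst p) = Some i} (w, \<omega>') \<partial>M)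
        = (\<integral>\<^sup>+\<omega>'. indicator {\<omega>\<in>space M. J \<omega> w = Some i} \<omega>' \<partial>M)"
      using True by (intro nn_integral_cong) (auto simp: indicator_def)
    then show ?thesis using True ctmc_sets[OF chain, of w] by simp
  qed simp
  have hit: "(\<integral>\<^sup>+\<omega>. indicator {\<omega>. 0 < W \<omega> \<and> J \<omega> (W \<omega>) = Some i} \<omega> \<partial>M) = (\<integral>\<^sup>+\<omega>. ?p i (W \<omega>) \<partial>M)" for i
  proof -
    have "(\<integral>\<^sup>+\<omega>. indicator {\<omega>. 0 < W \<omega> \<and> J \<omega> (W \<omega>) = Some i} \<omega> \<partial>M)
        = (\<integral>\<^sup>+\<omega>. indicator {p. 0 < fst p \<and> J (snd p) (fst p) = Some i} (W \<omega>, \<omega>) \<partial>M)"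
      by (intro nn_integral_cong) (auto simp: indicator_def)
    also have "\<dots> = (\<integral>\<^sup>+\<omega>. (\<integral>\<^sup>+\<omega>'. indicator {p. 0 < fst p \<and> J (snd p) (fst p) = Some i} (W \<omega>, \<omega>') \<partial>M) \<partial>M)"
      by (rule nn_integral_indep_clock) measurable
    finally show ?thesis by (simp only: p)
  qed
  have pm: "(\<lambda>\<omega>. ?p i (W \<omega>)) \<in> borel_measurable M" for i
  proof -
    have "Measurable.pred (borel \<Otimes>\<^sub>M M) (\<lambda>p. 0 < fst p \<and> J (snd p) (fst p) = Some i)"
      by (rule measurable_right_cont_process) (use ctmc_measurable[OF chain] ctmc_right_cont[OF chain] in auto)
    then have "(\<lambda>w. \<integral>\<^sup>+\<omega>'. indicator {p. 0 < fst p \<and> J (snd p) (fst p) = Some i} (w, \<omega>') \<partial>M) \<in> borel_measurable borel"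
      by measurable
    then have "(\<lambda>w. ?p i w) \<in> borel_measurable borel" by (simp only: p)
    then show ?thesis by (rule measurable_compose[OF W])
  qed
  let ?f = "\<lambda>p. indicator {p. 0 < fst p \<and> fst p \<le> lifetime (J (snd p))} p * h (lifetime (J (snd p)) - fst p)"
  have inner: "(\<integral>\<^sup>+\<omega>'. ?f (w, \<omega>') \<partial>M) = (\<Sum>i\<in>UNIV. ?p i w * (\<integral>\<^sup>+w. h (lifetime w) \<partial>P i))" for w
  proof (cases "0 < w")
    case True
    note [measurable] = borel_measurable_lifetime[OF chain] ctmc_measurable[OF chain less_imp_le[OF True]]
    have "(\<integral>\<^sup>+\<omega>'. ?f (w, \<omega>') \<partial>M)
        = (\<integral>\<^sup>+\<omega>'. (\<Sum>i\<in>UNIV. indicator {\<omega>. J \<omega> w = Some i} \<omega>' * h (lifetime (J \<omega>') - w)) \<partial>M)"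
    proof (rule nn_integral_cong_AE)
      show "AE \<omega>' in M. ?f (w, \<omega>') = (\<Sum>i\<in>UNIV. indicator {\<omega>. J \<omega> w = Some i} \<omega>' * h (lifetime (J \<omega>') - w))"
        using AE_lifetime_neq[OF chain True] AE_lifetime_le_iff[OF chain]
      proof eventually_elim
        fix \<omega>' assume *: "lifetime (J \<omega>') \<noteq> w" "\<forall>t\<ge>0. lifetime (J \<omega>') \<le> t \<longleftrightarrow> J \<omega>' t = None"
        have iff: "w \<le> lifetime (J \<omega>') \<longleftrightarrow> J \<omega>' w \<noteq> None"
          using * True by (metis less_imp_le linorder_not_le order.order_iff_strict)
        have "(\<Sum>i\<in>UNIV. indicator {\<omega>. J \<omega> w = Some i} \<omega>' :: ennreal) = (if J \<omega>' w \<noteq> None then 1 else 0)"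
        proof (cases "J \<omega>' w")
          case (Some j)
          have "(\<Sum>i\<in>UNIV. indicator {\<omega>. J \<omega> w = Some i} \<omega>' :: ennreal) = (\<Sum>i\<in>UNIV. if i = j then 1 else 0)"
            by (intro sum.cong) (auto simp: Some)
          then show ?thesis by (simp add: Some)
        qed auto
        then show "?f (w, \<omega>') = (\<Sum>i\<in>UNIV. indicator {\<omega>. J \<omega> w = Some i} \<omega>' * h (lifetime (J \<omega>') - w))"
          using iff True by (simp add: sum_distrib_right[symmetric])
      qed
    qed
    also have "\<dots> = (\<Sum>i\<in>UNIV. \<integral>\<^sup>+\<omega>'. indicator {\<omega>. J \<omega> w = Some i} \<omega>' * h (lifetime (J \<omega>') - w) \<partial>M)"
      by (rule nn_integral_sum) measurable
    also have "\<dots> = (\<Sum>i\<in>UNIV. ?p i w * (\<integral>\<^sup>+w. h (lifetime w) \<partial>P i))"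
      using True by (simp add: residual_lifetime[OF chain _ h])
    finally show ?thesis .
  qed simp
  have "(\<integral>\<^sup>+\<omega>. indicator {\<omega>. 0 < W \<omega> \<and> W \<omega> \<le> lifetime (J \<omega>)} \<omega> * h (lifetime (J \<omega>) - W \<omega>) \<partial>M)
      = (\<integral>\<^sup>+\<omega>. ?f (W \<omega>, \<omega>) \<partial>M)"
    by (intro nn_integral_cong) (auto simp: indicator_def)
  also have "\<dots> = (\<integral>\<^sup>+\<omega>. (\<integral>\<^sup>+\<omega>'. ?f (W \<omega>, \<omega>') \<partial>M) \<partial>M)"
    by (rule nn_integral_indep_clock) measurable
  also have "\<dots> = (\<integral>\<^sup>+\<omega>. (\<Sum>i\<in>UNIV. ?p i (W \<omega>) * (\<integral>\<^sup>+w. h (lifetime w) \<partial>P i)) \<partial>M)"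
    by (simp only: inner)
  also have "\<dots> = (\<Sum>i\<in>UNIV. (\<integral>\<^sup>+\<omega>. ?p i (W \<omega>) \<partial>M) * (\<integral>\<^sup>+w. h (lifetime w) \<partial>P i))"
    using pm by (subst nn_integral_sum) (simp_all add: nn_integral_multc)
  finally show ?thesis by (simp only: hit)
qed

end

end

section \<open>First passage of the embedded process\<close>

text \<open>The partial sums increase, so as soon as one of them exceeds \<open>t\<close> the set in
  \<^const>\<open>renewal_count\<close> is a finite initial segment.\<close>

lemma renewal_count_eq:
  assumes nonneg: "\<And>k. 1 \<le> k \<Longrightarrow> 0 \<le> s k"
    and t: "(\<Sum>k=1..n. s k) \<le> t" "t < (\<Sum>k=1..Suc n. s k)"
  shows "renewal_count s t = n"
proof -
  have mono: "(\<Sum>k=1..m. s k) \<le> (\<Sum>k=1..l. s k)" if "m \<le> l" for m l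
    by (rule sum_mono2) (use that nonneg in auto)
  have "{m. (\<Sum>k=1..m. s k) \<le> t} = {..n}"
    using t mono[of _ n] mono[of "Suc n"] by (force simp: not_less_eq_eq[symmetric])
  then show ?thesis
    unfolding renewal_count_def by (auto intro: Max_eqI)
qed

text \<open>During piece \<open>k + 1\<close>, which lasts for a time \<open>s (k + 1)\<close>, the embedded level rises with unit speed from
  \<open>lam * x k - u (k + 1)\<close> towards \<open>x (k + 1)\<close>. As long as the \<open>x k\<close> are below \<open>b\<close>, no
  completed piece has reached \<open>b\<close>; the first piece that ends above \<open>b\<close> reaches it at age \<open>v\<close>.\<close>

lemma embedded_passage:
  fixes s u x :: "nat \<Rightarrow> real"
  assumes nonneg: "\<And>k. 1 \<le> k \<Longrightarrow> 0 \<le> s k"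
    and step: "\<And>k. x (Suc k) = lam * x k + (s (Suc k) - u (Suc k))"
    and y: "\<And>t. 0 \<le> t \<Longrightarrow> y t = embedded_level lam x u s t"
    and below: "\<And>k. k \<le> n \<Longrightarrow> x k < b"
    and v: "v = b - lam * x n + u (Suc n)" "0 < v" "v < s (Suc n)"
  shows "level_passage b y = ereal ((\<Sum>k=1..n. s k) + v)"
    and "embedded_phase j s ((\<Sum>k=1..n. s k) + v) = j (Suc n) v"
proof -
  let ?\<sigma> = "\<lambda>n. \<Sum>k=1..n. s k"
  have \<sigma>_nonneg: "0 \<le> ?\<sigma> m" for m
    using nonneg by (intro sum_nonneg) auto
  have level: "y t = lam * x m - u (Suc m) + t - ?\<sigma> m" if "?\<sigma> m \<le> t" "t < ?\<sigma> (Suc m)" for m t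
    using y[of t] renewal_count_eq[OF nonneg that] that(1) \<sigma>_nonneg[of m]
    by (simp add: embedded_level_def Let_def)
  have hit: "?\<sigma> n \<le> ?\<sigma> n + v" "?\<sigma> n + v < ?\<sigma> (Suc n)"
    using v by simp_all
  show "embedded_phase j s (?\<sigma> n + v) = j (Suc n) v"
    using renewal_count_eq[OF nonneg hit] by (simp add: embedded_phase_def Let_def)
  show "level_passage b y = ereal (?\<sigma> n + v)"
    unfolding level_passage_def
  proof (rule antisym)
    show "(INF t\<in>{t. 0 \<le> t \<and> b \<le> y t}. ereal t) \<le> ereal (?\<sigma> n + v)"
      using level[OF hit] v \<sigma>_nonneg[of n] by (intro INF_lower) auto
    show "ereal (?\<sigma> n + v) \<le> (INF t\<in>{t. 0 \<le> t \<and> b \<le> y t}. ereal t)"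
    proof (rule INF_greatest, clarify)
      fix t assume t: "0 \<le> t" "b \<le> y t"
      show "ereal (?\<sigma> n + v) \<le> ereal t"
      proof (rule ccontr)
        assume "\<not> ereal (?\<sigma> n + v) \<le> ereal t"
        then have lt: "t < ?\<sigma> n + v" by simp
        then have ex: "t < ?\<sigma> (Suc n)" using hit by linarith
        \<comment> \<open>An earlier hit at \<open>t\<close> would happen during some piece \<open>m \<le> n\<close>.\<close>
        define m where "m = (LEAST m. t < ?\<sigma> (Suc m))"
        have m: "t < ?\<sigma> (Suc m)" "m \<le> n"
          unfolding m_def using ex by (rule LeastI, rule Least_le)
        have "?\<sigma> m \<le> t"
        proof (cases m)
          case (Suc l)
          then have "\<not> t < ?\<sigma> (Suc l)"
            unfolding m_def by (intro not_less_Least) simp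
          then show ?thesis by (simp add: Suc)
        qed (use t in simp)
        from level[OF this m(1)] have yt: "y t = lam * x m - u (Suc m) + t - ?\<sigma> m" .
        show False
        proof (cases "m = n")
          case True
          then show False using yt t lt v by simp
        next
          case False
          \<comment> \<open>Throughout the piece the level is below its end point \<open>x (Suc m)\<close>.\<close>
          then have "x (Suc m) < b" using m by (intro below) simp
          then show False using yt t m(1) step[of m] by simp
        qed
      qed
    qed
  qed
qed

lemma first_passage_eq_Suc:
  "first_passage b x = enat (Suc n) \<longleftrightarrow> (\<forall>k\<le>n. x k < b) \<and> b \<le> x (Suc n)"
proof (cases "\<exists>k. b \<le> x k")
  case True
  then have L: "b \<le> x (LEAST k. b \<le> x k)" by (rule LeastI_ex)
  have "first_passage b x = enat (LEAST k. b \<le> x k)"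
    unfolding first_passage_def
    by (intro antisym INF_lower INF_greatest) (auto intro: Least_le L)
  moreover have "(LEAST k. b \<le> x k) = Suc n \<longleftrightarrow> (\<forall>k\<le>n. x k < b) \<and> b \<le> x (Suc n)"
  proof
    assume "(LEAST k. b \<le> x k) = Suc n"
    moreover from this have "x k < b" if "k \<le> n" for k
      using not_less_Least[of k "\<lambda>k. b \<le> x k"] that by (simp add: not_le)
    ultimately show "(\<forall>k\<le>n. x k < b) \<and> b \<le> x (Suc n)"
      using L by simp
  next
    assume *: "(\<forall>k\<le>n. x k < b) \<and> b \<le> x (Suc n)"
    show "(LEAST k. b \<le> x k) = Suc n"
    proof (rule Least_equality)
      show "Suc n \<le> k" if "b \<le> x k" for k
        using * that by (meson not_less_eq_eq linorder_not_le)
    qed (use * in simp)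
  qed
  ultimately show ?thesis by simp
next
  case False
  then show ?thesis by (auto simp: first_passage_def Inf_enat_def)
qed

lemma first_passage_neq_0:
  assumes "x 0 < b"
  shows "first_passage b x \<noteq> 0"
proof -
  have "1 \<le> first_passage b x"
    unfolding first_passage_def
  proof (rule INF_greatest, clarify)
    fix k assume "b \<le> x k"
    then have "k \<noteq> 0" using assms by (intro notI) simp
    then show "1 \<le> enat k" by (simp add: one_enat_def)
  qed
  then show ?thesis by auto
qed

text \<open>At most one summand is nonzero. Writing the discounted value as a series separates the possible values of
  \<open>\<tau>\<close>, and covers \<open>\<tau> = \<infinity>\<close> as the empty case.\<close>

lemma ennreal_discounted:
  assumes "\<tau> \<noteq> 0" "0 \<le> \<rho>"
  shows "ennreal (discounted \<rho> \<tau> f)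
       = (\<Sum>n. ennreal (\<rho> ^ Suc n) * (indicator {enat (Suc n)} \<tau> * ennreal (f (Suc n))))"
proof (cases \<tau>)
  case (enat k)
  then obtain m where k: "k = Suc m" using assms(1) by (cases k) (auto simp: zero_enat_def)
  have "(\<Sum>n. ennreal (\<rho> ^ Suc n) * (indicator {enat (Suc n)} \<tau> * ennreal (f (Suc n))))
      = (\<Sum>n\<in>{m}. ennreal (\<rho> ^ Suc n) * (indicator {enat (Suc n)} \<tau> * ennreal (f (Suc n))))"
    by (rule suminf_finite) (auto simp: enat k)
  also have "\<dots> = ennreal (\<rho> ^ Suc m * f (Suc m))"
    using assms(2) by (simp add: enat k ennreal_mult' del: power_Suc)
  finally show ?thesis by (simp add: discounted_def enat k)
qed (simp add: discounted_def)

section \<open>Crossing ages\<close>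

text \<open>The age at which piece \<open>n + 1\<close> of the embedded level, if it lasts long enough, reaches \<open>b\<close>. The value
  \<open>-1\<close> records that the sequence reached \<open>b\<close> before, so that positivity of this one number carries all that the
  first passage needs to know about the past.\<close>

definition crossing_age :: "real \<Rightarrow> real \<Rightarrow> (nat \<Rightarrow> real) \<Rightarrow> (nat \<Rightarrow> real) \<Rightarrow> nat \<Rightarrow> real" where
  "crossing_age b lam x u n = (if \<forall>k\<le>n. x k < b then b - lam * x n + u (Suc n) else -1)"

text \<open>A new piece always starts below \<open>b\<close> if the last value was below \<open>b\<close>, since contraction towards
  \<open>0 \<le> b\<close> followed by a jump down cannot cross \<open>b\<close>.\<close>

lemma crossing_age_pos_iff:
  assumes "0 < lam" "lam < 1" "0 \<le> b" "0 \<le> u (Suc n)"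
  shows "0 < crossing_age b lam x u n \<longleftrightarrow> (\<forall>k\<le>n. x k < b)"
proof -
  \<comment> \<open>For nonnegative \<open>x n\<close> contraction lowers the level; for negative \<open>x n\<close> it keeps it negative.\<close>
  have "lam * x n < b" if "x n < b"
  proof (cases "0 \<le> x n")
    case True
    then have "lam * x n \<le> 1 * x n" using assms by (intro mult_right_mono) auto
    then show ?thesis using that by simp
  next
    case False
    then have "lam * x n < 0" using assms by (simp add: mult_less_0_iff)
    then show ?thesis using assms by simp
  qed
  then show ?thesis using assms(4) by (auto simp: crossing_age_def)
qed

lemma first_passage_eq_Suc_iff_crossing_age:
  assumes "0 < lam" "lam < 1" "0 \<le> b" "0 \<le> u (Suc n)"
    and step: "x (Suc n) = lam * x n + (s - u (Suc n))"
  shows "first_passage b x = enat (Suc n) \<longleftrightarrow>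
      0 < crossing_age b lam x u n \<and> crossing_age b lam x u n \<le> s"
  using crossing_age_pos_iff[where x=x and n=n and u=u, OF assms(1-4)] step
  unfolding first_passage_eq_Suc by (auto simp: crossing_age_def)

context
  fixes M :: "'w measure" and J :: "nat \<Rightarrow> 'w \<Rightarrow> real \<Rightarrow> 'm option" and T X :: "nat \<Rightarrow> 'w \<Rightarrow> real"
    and lam x b :: real
  assumes M: "prob_space M"
    and rc: "\<And>n \<omega>. 1 \<le> n \<Longrightarrow> \<omega> \<in> space M \<Longrightarrow> right_cont_path (J n \<omega>)"
    and indep: "prob_space.indep_sets M
              (\<lambda>k. case k of Inl n \<Rightarrow> process_sigma M (J n) | Inr n \<Rightarrow> variable_sigma M (T n))
              ({1..} <+> {1..})"
    and X_0: "\<And>\<omega>. \<omega> \<in> space M \<Longrightarrow> X 0 \<omega> = x"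
    and X_Suc: "\<And>n \<omega>. \<omega> \<in> space M \<Longrightarrow>
              X (Suc n) \<omega> = lam * X n \<omega> + (lifetime (J (Suc n) \<omega>) - T (Suc n) \<omega>)"
begin

text \<open>The crossing age of piece \<open>n + 1\<close> is a function of the chains up to index \<open>n\<close> and of the jumps \<open>T\<close> up to index
  \<open>n + 1\<close>; the chain that drives this piece is not among them.\<close>

lemma indep_crossing_age:
  defines "W \<equiv> \<lambda>n \<omega>. crossing_age b lam (\<lambda>k. X k \<omega>) (\<lambda>k. T k \<omega>) n"
  shows "prob_space.indep_set M (variable_sigma M (W n)) (process_sigma M (J (Suc n)))" (is ?indep)
    and "W n \<in> borel_measurable M"
proof -
  interpret prob_space M by (rule M)
  let ?E = "\<lambda>k. case k of Inl n \<Rightarrow> process_sigma M (J n) | Inr n \<Rightarrow> variable_sigma M (T n)"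
  let ?past = "Inl ` {1..n} \<union> Inr ` {1..Suc n} :: (nat + nat) set" and ?new = "{Inl (Suc n)} :: (nat + nat) set"
  have Int_stable: "Int_stable (?E k)" for k
    by (cases k) (auto simp: process_sigma_def variable_sigma_def intro: sets.Int_stable)
  have "indep_sets (\<lambda>j. sigma_sets (space M) (\<Union>k\<in>case_bool ?past ?new j. ?E k)) UNIV"
  proof (rule indep_sets_collect_sigma)
    show "indep_sets ?E (\<Union>j\<in>UNIV. case_bool ?past ?new j)"
      by (rule indep_sets_mono_index[OF _ indep]) (auto split: bool.splits)
    show "disjoint_family_on (case_bool ?past ?new) UNIV"
      by (auto simp: disjoint_family_on_def split: bool.splits)
  qed (rule Int_stable)
  then have "indep_set (sigma_sets (space M) (\<Union>k\<in>?past. ?E k)) (sigma_sets (space M) (\<Union>k\<in>?new. ?E k))"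
    unfolding indep_set_def by (rule indep_sets_mono_sets) (auto split: bool.splits)
  \<comment> \<open>\<open>F\<close> is the information that determines \<open>X n\<close> and \<open>T (Suc n)\<close>.\<close>
  moreover define F where "F = sigma (space M) (\<Union>k\<in>?past. ?E k)"
  have E_space: "?E k \<subseteq> Pow (space M)" for k
    using sets.space_closed[of "process_algebra M (J n)" for n]
      sets.space_closed[of "vimage_algebra (space M) (T n) borel" for n]
    by (cases k) (simp_all add: sets_process_algebra variable_sigma_def)
  then have sets_F: "sets F = sigma_sets (space M) (\<Union>k\<in>?past. ?E k)" and space_F: "space F = space M"
    unfolding F_def by (auto simp: UN_subset_iff simp del: UN_Un intro!: sets_measure_of space_measure_of)
  ultimately have indep_F: "indep_set (sets F) (sigma_sets (space M) (\<Union>k\<in>?new. ?E k))" by simp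
  have E_F: "?E k \<subseteq> sets F" if "k \<in> ?past" for k
    unfolding sets_F using that by (auto intro!: sigma_sets.Basic)
  have T: "T k \<in> borel_measurable F" if "1 \<le> k" "k \<le> Suc n" for k
  proof (rule measurableI)
    fix B :: "real set" assume B: "B \<in> sets borel"
    have "T k -` B \<inter> space M \<in> variable_sigma M (T k)"
      unfolding variable_sigma_def using B by (rule in_vimage_algebra)
    then show "T k -` B \<inter> space F \<in> sets F"
      using E_F[of "Inr k"] that by (auto simp: space_F)
  qed simp
  have L: "(\<lambda>\<omega>. lifetime (J k \<omega>)) \<in> borel_measurable F" if k: "1 \<le> k" "k \<le> n" for k
    unfolding lifetime_def
  proof (intro borel_measurable_real_of_ereal borel_measurable_absorption_time)
    fix t :: real assume "0 \<le> t"
    then have J: "(\<lambda>\<omega>. J k \<omega> t) \<in> process_algebra M (J k) \<rightarrow>\<^sub>M count_space UNIV"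
      by (rule measurable_process_algebra)
    show "(\<lambda>\<omega>. J k \<omega> t) \<in> F \<rightarrow>\<^sub>M count_space UNIV"
      using measurable_sets[OF J] E_F[of "Inl k"] k
      by (intro measurableI) (auto simp: space_F sets_process_algebra)
  qed (use rc k space_F in auto)
  have X: "X k \<in> borel_measurable F" if "k \<le> n" for k
    using that
  proof (induction k)
    case 0
    show ?case using X_0 by (subst measurable_cong[of F _ "\<lambda>_. x"]) (auto simp: space_F)
  next
    case (Suc k)
    then have [measurable]: "X k \<in> borel_measurable F" "T (Suc k) \<in> borel_measurable F"
        "(\<lambda>\<omega>. lifetime (J (Suc k) \<omega>)) \<in> borel_measurable F"
      using T L by auto
    have "(\<lambda>\<omega>. lam * X k \<omega> + (lifetime (J (Suc k) \<omega>) - T (Suc k) \<omega>)) \<in> borel_measurable F"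
      by measurable
    then show ?case using X_Suc[of _ k] by (subst measurable_cong) (auto simp: space_F)
  qed
  have W_F: "W n \<in> borel_measurable F"
  proof -
    \<comment> \<open>Replacing \<open>k\<close> by \<open>min k n\<close> turns the bounded quantifier into a quantifier over all \<open>k\<close>
      whose instances are all measurable with respect to \<open>F\<close>.\<close>
    have [measurable]: "X (min k n) \<in> borel_measurable F" for k by (rule X) simp
    have [measurable]: "X n \<in> borel_measurable F" "T (Suc n) \<in> borel_measurable F" using X T by auto
    have "W n = (\<lambda>\<omega>. if \<forall>k. X (min k n) \<omega> < b then b - lam * X n \<omega> + T (Suc n) \<omega> else -1)"
    proof -
      have "(\<forall>k\<le>n. X k \<omega> < b) \<longleftrightarrow> (\<forall>k. X (min k n) \<omega> < b)" for \<omega>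
        by (metis min.cobounded2 min_absorb1)
      then show ?thesis by (simp add: W_def crossing_age_def fun_eq_iff)
    qed
    then show ?thesis by simp
  qed
  have "variable_sigma M (W n) \<subseteq> sets F"
  proof
    fix A assume "A \<in> variable_sigma M (W n)"
    then obtain B where "B \<in> sets borel" "A = W n -` B \<inter> space M"
      unfolding variable_sigma_def by (auto simp: sets_vimage_algebra2)
    then show "A \<in> sets F" using measurable_sets[OF W_F, of B] by (simp add: space_F)
  qed
  moreover have "process_sigma M (J (Suc n)) \<subseteq> sigma_sets (space M) (\<Union>k\<in>?new. ?E k)"
    by auto
  ultimately show ?indep
    using indep_F unfolding indep_sets2_eq by blast
  have "sets F \<subseteq> events" using indep_F by (rule indep_setD_ev1)
  then show "W n \<in> borel_measurable M"
    using measurable_sets[OF W_F] by (intro measurableI) (auto simp: space_F)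
qed

end

section \<open>The law of the overshoot\<close>

theorem corollary2p6:
  fixes M :: "'w measure"
    and Q :: "real^'m^('m::finite)" and \<alpha> :: "real^'m"
    and J :: "nat \<Rightarrow> 'w \<Rightarrow> real \<Rightarrow> 'm option"
    and S T X :: "nat \<Rightarrow> 'w \<Rightarrow> real"
    and \<tau> :: "'w \<Rightarrow> enat" and \<tau>h :: "'w \<Rightarrow> ereal"
    and Jt :: "'w \<Rightarrow> real \<Rightarrow> 'm option" and Y :: "'w \<Rightarrow> real \<Rightarrow> real"
    and G :: "'m \<Rightarrow> 'w set"
    and N :: "'m \<Rightarrow> 'c measure" and R :: "'m \<Rightarrow> 'c \<Rightarrow> real"
    and lam x b \<rho> :: real and g :: "real \<Rightarrow> real"
  assumes M: "prob_space M"
    and gen: "is_generator (absorbing_generator Q)"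
    and trans: "\<And>i. transient_state (absorbing_generator Q) (Some i)"
    and alpha: "\<And>i. 0 \<le> \<alpha> $ i" "(\<Sum>i\<in>UNIV. \<alpha> $ i) = 1"
    and lam: "0 < lam" "lam < 1"
    and chain: "\<And>n. 1 \<le> n \<Longrightarrow> ctmc M (J n) (absorbing_generator Q) (initial_dist \<alpha>)"
    and S: "\<And>n \<omega>. 1 \<le> n \<Longrightarrow> \<omega> \<in> space M \<Longrightarrow>
              S n \<omega> = real_of_ereal (absorption_time (J n \<omega>))"
    and T_rv: "\<And>n. 1 \<le> n \<Longrightarrow> T n \<in> borel_measurable M"
    and T_nonneg: "\<And>n. 1 \<le> n \<Longrightarrow> AE \<omega> in M. 0 \<le> T n \<omega>"
    and T_ident: "\<And>n. 1 \<le> n \<Longrightarrow> distr M borel (T n) = distr M borel (T 1)"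
    and indep: "prob_space.indep_sets M
              (\<lambda>k. case k of Inl n \<Rightarrow> process_sigma M (J n) | Inr n \<Rightarrow> variable_sigma M (T n))
              ({1..} <+> {1..})"
    and X_0: "\<And>\<omega>. \<omega> \<in> space M \<Longrightarrow> X 0 \<omega> = x"
    and X_step: "\<And>n \<omega>. 1 \<le> n \<Longrightarrow> \<omega> \<in> space M \<Longrightarrow>
              X n \<omega> = lam * X (n - 1) \<omega> + (S n \<omega> - T n \<omega>)"
    and Jt: "\<And>\<omega> t. \<omega> \<in> space M \<Longrightarrow> 0 \<le> t \<Longrightarrow>
              Jt \<omega> t = embedded_phase (\<lambda>n. J n \<omega>) (\<lambda>n. S n \<omega>) t"
    and Y: "\<And>\<omega> t. \<omega> \<in> space M \<Longrightarrow> 0 \<le> t \<Longrightarrow>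
              Y \<omega> t = embedded_level lam (\<lambda>n. X n \<omega>) (\<lambda>n. T n \<omega>) (\<lambda>n. S n \<omega>) t"
    and tau: "\<And>\<omega>. \<omega> \<in> space M \<Longrightarrow> \<tau> \<omega> = first_passage b (\<lambda>n. X n \<omega>)"
    and tau_hat: "\<And>\<omega>. \<omega> \<in> space M \<Longrightarrow> \<tau>h \<omega> = level_passage b (Y \<omega>)"
    and G: "\<And>i. G i = {\<omega>\<in>space M. \<tau>h \<omega> < \<infinity> \<and> Jt \<omega> (real_of_ereal (\<tau>h \<omega>)) = Some i}"
    and b: "0 \<le> b" and x: "x < b" and rho: "0 < \<rho>" "\<rho> \<le> 1"
    and g: "g \<in> borel_measurable borel" "\<And>y. 0 \<le> g y"
    and R_space: "\<And>i. prob_space (N i)"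
    and R_rv: "\<And>i. R i \<in> borel_measurable (N i)"
    and R_dist: "\<And>i. phase_type Q (axis i 1) (distr (N i) borel (R i))"
  shows "(\<integral>\<^sup>+\<omega>. ennreal (discounted \<rho> (\<tau> \<omega>) (\<lambda>k. g (X k \<omega>))) \<partial>M) =
         (\<Sum>i\<in>UNIV. (\<integral>\<^sup>+\<omega>. ennreal (discounted \<rho> (\<tau> \<omega>) (\<lambda>_. indicator (G i) \<omega>)) \<partial>M) *
                     (\<integral>\<^sup>+\<omega>. ennreal (g (b + R i \<omega>)) \<partial>(N i)))"
proof -
  interpret prob_space M by (rule M)
  let ?A = "absorbing_generator Q"
  have "\<forall>i. \<exists>P :: (real \<Rightarrow> 'm option) measure. ctmc P (\<lambda>w. w) ?A (axis (Some i) 1)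
      \<and> distr (N i) borel (R i) = distr P borel lifetime"
    using R_dist unfolding phase_type_def initial_dist_axis lifetime_def[abs_def] by blast
  then obtain P :: "'m \<Rightarrow> (real \<Rightarrow> 'm option) measure" where
    P: "\<And>i. ctmc (P i) (\<lambda>w. w) ?A (axis (Some i) 1)"
    and R_law: "\<And>i. distr (N i) borel (R i) = distr (P i) borel lifetime"
    by metis
  interpret transient_generator Q P
    by standard (fact trans, fact P)
  have S_eq: "S (Suc n) \<omega> = lifetime (J (Suc n) \<omega>)" if "\<omega> \<in> space M" for n \<omega>
    unfolding lifetime_def by (rule S) (use that in simp_all)
  have X_Suc: "X (Suc n) \<omega> = lam * X n \<omega> + (lifetime (J (Suc n) \<omega>) - T (Suc n) \<omega>)"
    if "\<omega> \<in> space M" for n \<omega>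
    using X_step[of "Suc n" \<omega>] that by (simp add: S_eq)
  have chain': "ctmc M (J (Suc n)) ?A (initial_dist \<alpha>)" for n
    using chain by simp
  define W where "W n \<omega> = crossing_age b lam (\<lambda>k. X k \<omega>) (\<lambda>k. T k \<omega>) n" for n \<omega>
  have W: "indep_set (variable_sigma M (W n)) (process_sigma M (J (Suc n)))"
    "W n \<in> borel_measurable M" for n
  proof -
    have rc: "\<And>n \<omega>. 1 \<le> n \<Longrightarrow> \<omega> \<in> space M \<Longrightarrow> right_cont_path (J n \<omega>)"
      by (rule ctmc_right_cont[OF chain])
    show "indep_set (variable_sigma M (W n)) (process_sigma M (J (Suc n)))"
      "W n \<in> borel_measurable M"
      unfolding W_def[abs_def]
      by (rule indep_crossing_age[OF M rc indep X_0 X_Suc], assumption+)+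
  qed
  let ?h = "\<lambda>r. ennreal (g (b + r))"
  have h: "?h \<in> borel_measurable borel" using g(1) by measurable
  have R_int: "(\<integral>\<^sup>+\<omega>. ennreal (g (b + R i \<omega>)) \<partial>(N i)) = (\<integral>\<^sup>+w. ?h (lifetime w) \<partial>P i)" for i
  proof -
    have "(\<integral>\<^sup>+\<omega>. ?h (R i \<omega>) \<partial>(N i)) = (\<integral>\<^sup>+r. ?h r \<partial>distr (N i) borel (R i))"
      using R_rv h by (intro nn_integral_distr[symmetric]) auto
    also have "\<dots> = (\<integral>\<^sup>+w. ?h (lifetime w) \<partial>P i)"
      unfolding R_law using borel_measurable_lifetime[OF P] h by (intro nn_integral_distr) auto
    finally show ?thesis .
  qed
  \<comment> \<open>Up to null sets, \<open>D n\<close> is \<open>\<tau> = n + 1\<close>, and \<open>H i n\<close> is \<open>\<tau> = n + 1\<close> together with \<open>G i\<close>.\<close>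
  define D where "D n = {\<omega>. 0 < W n \<omega> \<and> W n \<omega> \<le> lifetime (J (Suc n) \<omega>)}" for n
  define H where "H i n = {\<omega>. 0 < W n \<omega> \<and> J (Suc n) \<omega> (W n \<omega>) = Some i}" for i n
  have tau_nonzero: "\<tau> \<omega> \<noteq> 0" if "\<omega> \<in> space M" for \<omega>
    using first_passage_neq_0[of "\<lambda>k. X k \<omega>" b] X_0 x tau that by simp
  have AE_T: "AE \<omega> in M. \<forall>n. 0 \<le> T (Suc n) \<omega>"
    unfolding AE_all_countable using T_nonneg by simp
  have AE_tau: "AE \<omega> in M. \<forall>n. \<tau> \<omega> = enat (Suc n) \<longleftrightarrow> \<omega> \<in> D n"
    using AE_T AE_space
  proof eventually_elim
    fix \<omega> assume *: "\<forall>n. 0 \<le> T (Suc n) \<omega>" "\<omega> \<in> space M"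
    show "\<forall>n. \<tau> \<omega> = enat (Suc n) \<longleftrightarrow> \<omega> \<in> D n"
      using first_passage_eq_Suc_iff_crossing_age[OF lam b, of "\<lambda>k. T k \<omega>" _ "\<lambda>k. X k \<omega>"]
        * X_Suc tau by (simp add: D_def W_def)
  qed
  have AE_G: "AE \<omega> in M. \<forall>n i. (\<tau> \<omega> = enat (Suc n) \<and> \<omega> \<in> G i) \<longleftrightarrow> \<omega> \<in> H i n"
  proof -
    have "AE \<omega> in M. \<forall>n. 0 < W n \<omega> \<longrightarrow> lifetime (J (Suc n) \<omega>) \<noteq> W n \<omega>"
      unfolding AE_all_countable using AE_lifetime_neq_indep[OF chain' W(2) W(1)] by blast
    moreover have "AE \<omega> in M. \<forall>n. \<forall>t\<ge>0. lifetime (J (Suc n) \<omega>) \<le> t \<longleftrightarrow> J (Suc n) \<omega> t = None"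
      unfolding AE_all_countable using AE_lifetime_le_iff[OF chain'] by blast
    ultimately show ?thesis
      using AE_T AE_tau AE_space
    proof eventually_elim
      fix \<omega>
      assume neq: "\<forall>n. 0 < W n \<omega> \<longrightarrow> lifetime (J (Suc n) \<omega>) \<noteq> W n \<omega>"
        and le: "\<forall>n. \<forall>t\<ge>0. lifetime (J (Suc n) \<omega>) \<le> t \<longleftrightarrow> J (Suc n) \<omega> t = None"
        and T: "\<forall>n. 0 \<le> T (Suc n) \<omega>"
        and D: "\<forall>n. \<tau> \<omega> = enat (Suc n) \<longleftrightarrow> \<omega> \<in> D n"
        and \<omega>: "\<omega> \<in> space M"
      \<comment> \<open>The strict inequality \<open>W n \<omega> < lifetime (J (Suc n) \<omega>)\<close> matters: in case of equality the embedded
        level would only reach \<open>b\<close> during a later piece.\<close>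
      have G_iff: "\<omega> \<in> G i \<longleftrightarrow> J (Suc n) \<omega> (W n \<omega>) = Some i" if "\<omega> \<in> D n" for n i
      proof -
        have v: "0 < W n \<omega>" "W n \<omega> < lifetime (J (Suc n) \<omega>)"
          using that neq by (auto simp: D_def order_less_le)
        have below: "\<forall>k\<le>n. X k \<omega> < b"
          using v(1) by (auto simp: W_def crossing_age_def split: if_splits)
        then have Wv: "W n \<omega> = b - lam * X n \<omega> + T (Suc n) \<omega>"
          by (simp add: W_def crossing_age_def)
        have nonneg: "0 \<le> S k \<omega>" if "1 \<le> k" for k
          using S_eq[OF \<omega>, of "k - 1"] lifetime_nonneg that by simp
        have step: "X (Suc k) \<omega> = lam * X k \<omega> + (S (Suc k) \<omega> - T (Suc k) \<omega>)" for k
          using X_Suc[OF \<omega>] S_eq[OF \<omega>] by simp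
        let ?t = "(\<Sum>k=1..n. S k \<omega>) + W n \<omega>"
        note passage = embedded_passage[where s="\<lambda>k. S k \<omega>" and x="\<lambda>k. X k \<omega>" and u="\<lambda>k. T k \<omega>"
            and y="Y \<omega>" and n=n and b=b and v="W n \<omega>",
            OF nonneg step Y[OF \<omega>] below[rule_format] Wv v(1) v(2)[folded S_eq[OF \<omega>]]]
        have "0 \<le> ?t" using v(1) nonneg by (intro add_nonneg_nonneg sum_nonneg) auto
        moreover have "\<tau>h \<omega> = ereal ?t" using passage(1) tau_hat[OF \<omega>] by simp
        ultimately show ?thesis
          using passage(2)[of "\<lambda>k. J k \<omega>"] Jt[OF \<omega>, of ?t] \<omega> by (simp add: G)
      qed
      have "\<omega> \<in> H i n \<longleftrightarrow> \<omega> \<in> D n \<and> J (Suc n) \<omega> (W n \<omega>) = Some i" for i n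
        using le[rule_format, of "W n \<omega>" n] by (auto simp: H_def D_def)
      then show "\<forall>n i. (\<tau> \<omega> = enat (Suc n) \<and> \<omega> \<in> G i) \<longleftrightarrow> \<omega> \<in> H i n"
        using D G_iff by auto
    qed
  qed
  have meas_D: "(\<lambda>\<omega>. indicator (D n) \<omega> * ?h (lifetime (J (Suc n) \<omega>) - W n \<omega>)) \<in> borel_measurable M" for n
  proof -
    note [measurable] = W(2) borel_measurable_lifetime[OF chain'] h
    show ?thesis unfolding D_def by measurable
  qed
  have meas_H: "(indicator (H i n) :: _ \<Rightarrow> ennreal) \<in> borel_measurable M" for i n
  proof -
    have "H i n \<inter> space M \<in> sets M"
      using ctmc_state_at_measurable[OF chain'[of n] W(2)[of n], of "Some i"]
      by (simp add: H_def Int_def conj_commute)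
    then show ?thesis by (simp add: borel_measurable_indicator_iff)
  qed
  have lhs: "(\<integral>\<^sup>+\<omega>. ennreal (discounted \<rho> (\<tau> \<omega>) (\<lambda>k. g (X k \<omega>))) \<partial>M)
      = (\<Sum>n. ennreal (\<rho> ^ Suc n) * (\<integral>\<^sup>+\<omega>. indicator (D n) \<omega> * ?h (lifetime (J (Suc n) \<omega>) - W n \<omega>) \<partial>M))"
  proof -
    have "(\<integral>\<^sup>+\<omega>. ennreal (discounted \<rho> (\<tau> \<omega>) (\<lambda>k. g (X k \<omega>))) \<partial>M)
        = (\<integral>\<^sup>+\<omega>. (\<Sum>n. ennreal (\<rho> ^ Suc n) * (indicator (D n) \<omega> * ?h (lifetime (J (Suc n) \<omega>) - W n \<omega>))) \<partial>M)"
    proof (rule nn_integral_cong_AE)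
      show "AE \<omega> in M. ennreal (discounted \<rho> (\<tau> \<omega>) (\<lambda>k. g (X k \<omega>)))
          = (\<Sum>n. ennreal (\<rho> ^ Suc n) * (indicator (D n) \<omega> * ?h (lifetime (J (Suc n) \<omega>) - W n \<omega>)))"
        using AE_tau AE_space
      proof eventually_elim
        fix \<omega> assume D: "\<forall>n. \<tau> \<omega> = enat (Suc n) \<longleftrightarrow> \<omega> \<in> D n" and \<omega>: "\<omega> \<in> space M"
        have "indicator {enat (Suc n)} (\<tau> \<omega>) * ennreal (g (X (Suc n) \<omega>))
            = indicator (D n) \<omega> * ?h (lifetime (J (Suc n) \<omega>) - W n \<omega>)" for n
        proof (cases "\<omega> \<in> D n")
          case True
          then have "W n \<omega> = b - lam * X n \<omega> + T (Suc n) \<omega>"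
            by (auto simp: D_def W_def crossing_age_def split: if_splits)
          then have "b + (lifetime (J (Suc n) \<omega>) - W n \<omega>) = X (Suc n) \<omega>"
            using X_Suc[OF \<omega>, of n] by simp
          then show ?thesis using True D by simp
        next
          case False
          then show ?thesis using D by (auto simp: indicator_def)
        qed
        then show "ennreal (discounted \<rho> (\<tau> \<omega>) (\<lambda>k. g (X k \<omega>)))
          = (\<Sum>n. ennreal (\<rho> ^ Suc n) * (indicator (D n) \<omega> * ?h (lifetime (J (Suc n) \<omega>) - W n \<omega>)))"
          using ennreal_discounted[OF tau_nonzero[OF \<omega>] less_imp_le[OF rho(1)]] by simp
      qed
    qed
    then show ?thesis
      using meas_D by (simp add: nn_integral_suminf nn_integral_cmult)
  qed
  have rhs: "(\<integral>\<^sup>+\<omega>. ennreal (discounted \<rho> (\<tau> \<omega>) (\<lambda>_. indicator (G i) \<omega>)) \<partial>M)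
      = (\<Sum>n. ennreal (\<rho> ^ Suc n) * (\<integral>\<^sup>+\<omega>. indicator (H i n) \<omega> \<partial>M))" for i
  proof -
    have "(\<integral>\<^sup>+\<omega>. ennreal (discounted \<rho> (\<tau> \<omega>) (\<lambda>_. indicator (G i) \<omega>)) \<partial>M)
        = (\<integral>\<^sup>+\<omega>. (\<Sum>n. ennreal (\<rho> ^ Suc n) * indicator (H i n) \<omega>) \<partial>M)"
    proof (rule nn_integral_cong_AE)
      show "AE \<omega> in M. ennreal (discounted \<rho> (\<tau> \<omega>) (\<lambda>_. indicator (G i) \<omega>))
          = (\<Sum>n. ennreal (\<rho> ^ Suc n) * indicator (H i n) \<omega>)"
        using AE_G AE_space
      proof eventually_elim
        fix \<omega> assume G: "\<forall>n i. (\<tau> \<omega> = enat (Suc n) \<and> \<omega> \<in> G i) \<longleftrightarrow> \<omega> \<in> H i n" and \<omega>: "\<omega> \<in> space M"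
        have "indicator {enat (Suc n)} (\<tau> \<omega>) * ennreal (indicator (G i) \<omega>) = indicator (H i n) \<omega>" for n
          using G[rule_format, of n i] by (auto simp: indicator_def)
        then show "ennreal (discounted \<rho> (\<tau> \<omega>) (\<lambda>_. indicator (G i) \<omega>))
          = (\<Sum>n. ennreal (\<rho> ^ Suc n) * indicator (H i n) \<omega>)"
          using ennreal_discounted[OF tau_nonzero[OF \<omega>] less_imp_le[OF rho(1)]] by simp
      qed
    qed
    then show ?thesis
      using meas_H by (simp add: nn_integral_suminf nn_integral_cmult del: nn_integral_indicator)
  qed
  have "(\<integral>\<^sup>+\<omega>. ennreal (discounted \<rho> (\<tau> \<omega>) (\<lambda>k. g (X k \<omega>))) \<partial>M)
      = (\<Sum>n. \<Sum>i\<in>UNIV. ennreal (\<rho> ^ Suc n) * (\<integral>\<^sup>+\<omega>. indicator (H i n) \<omega> \<partial>M)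
            * (\<integral>\<^sup>+w. ?h (lifetime w) \<partial>P i))"
    unfolding lhs D_def H_def
    by (subst overshoot[OF chain' W(2) W(1) h]) (simp only: sum_distrib_left mult.assoc)
  also have "\<dots> = (\<Sum>i\<in>UNIV. (\<Sum>n. ennreal (\<rho> ^ Suc n) * (\<integral>\<^sup>+\<omega>. indicator (H i n) \<omega> \<partial>M)
            * (\<integral>\<^sup>+w. ?h (lifetime w) \<partial>P i)))"
    by (rule suminf_sum) (rule summableI)
  also have "\<dots> = (\<Sum>i\<in>UNIV. (\<integral>\<^sup>+\<omega>. ennreal (discounted \<rho> (\<tau> \<omega>) (\<lambda>_. indicator (G i) \<omega>)) \<partial>M) *
                     (\<integral>\<^sup>+\<omega>. ennreal (g (b + R i \<omega>)) \<partial>(N i)))"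
    unfolding rhs R_int by (simp only: ennreal_suminf_multc)
  finally show ?thesis .
qed

end
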